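(* Let $\mathcal C$ be a rigid C*-tensor category with simple unit $\mathbbm 1$ and at most countably many isomorphism classes of simple objects. Then the tube cone $\Sigma^2\mathcal C$ is salient, that is, $\Sigma^2\mathcal C\cap(-\Sigma^2\mathcal C)=\{0\}$.
   Context: Conventions: C*-tensor categories are strict, essentially small, and closed under finite direct sums and passage to sub-objects. $\mathcal C(x,y)$ is the space of morphisms from $x$ to $y$. Rigid means every object $X$ has a conjugate $\overline X$ with $R\in\mathcal C(\mathbbm 1,\overline X\otimes X)$, $\overline R\in\mathcal C(\mathbbm 1,X\otimes\overline X)$ such that $(1_{\overline X}\otimes\overline R^* )(R\otimes 1_{\overline X})=1_{\overline X}$ and $(1_X\otimes R^* )(\overline R\otimes 1_X)=1_X$; the pair $(R,\overline R)$ is standard if $R^*(1\otimes f)R=\overline R^*(f\otimes 1)\overline R$ for all $f\in\mathrm{End}(X)$. Standard solutions $(R_X,\overline R_X)$ are fixed for all objects (fixed for irreducibles and extended by naturality). $\mathrm{Irr}$ is a fixed set of representatives of the isomorphism classes of simple objects (with $\mathbbm 1\in \mathrm{Irr}$); simple objects are not distinguished from their classes. Fusion algebra: $\mathbb C[\mathcal C]$ is the unital $*$-algebra with linear basis $\mathrm{Irr}$, product $x\cdot y=\sum_{z\in\mathrm{Irr}}\dim\mathcal C(z,x\otimes y)\,z$, involution the conjugate-linear extension of $x^*=\overline x$, and unit $\mathbbm 1$. Tube algebra: $\mathcal A=\bigoplus_{x,y\in\mathrm{Irr}}\mathcal A_{x,y}$, $\mathcal A_{x,y}=\bigoplus_{w\in\mathrm{Irr}}\mathcal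 A^w_{x,y}$, $\mathcal A^w_{x,y}=\mathcal C(w\otimes x,y\otimes w)$. For an object $z$ and $\gamma\in\mathcal C(z\otimes x,y\otimes z)$, let $\Psi^z_{x,y}(\gamma)\in\mathcal A_{x,y}$ be the element with $w$-component $\sum_{\alpha}(1_y\otimes\alpha^* )\gamma(\alpha\otimes 1_x)$, where $\alpha$ runs over an orthonormal basis of $\mathcal C(w,z)$ for the inner product $\tau^*\sigma=\langle\sigma,\tau\rangle 1_w$. Every element of $\mathcal A_{x,y}$ is of this form for some $z,\gamma$. $\mathcal A$ is a $*$-algebra via the (well-defined) operations $\Psi^{z_1}_{x_1,y_1}(\gamma_1)\cdot\Psi^{z_2}_{x_2,y_2}(\gamma_2)=\delta_{x_1=y_2}\Psi^{z_1\otimes z_2}_{x_2,y_1}\big((\gamma_1\otimes 1_{z_2})(1_{z_1}\otimes\gamma_2)\big)\in\mathcal A_{x_2,y_1}$ and $\Psi^z_{x,y}(\gamma)^*=\Psi^{\overline z}_{y,x}\big((R_z^*\otimes 1_x\otimes 1_{\overline z})(1_{\overline z}\otimes\gamma^*\otimes 1_{\overline z})(1_{\overline z}\otimes 1_y\otimes\overline R_z)\big)\in\mathcal A_{y,x}$. The map $w\mapsto\Psi^w_{\mathbbm 1,\mathbbm 1}(1_w)$ ($w\in\mathrm{Irr}$) is a unital $*$-isomorphism $\mathbb C[\mathcal C]\cong\mathcal A_{\mathbbm 1,\mathbbm 1}$, used as an identification. Tube cone: $\Sigma^2\mathcal C=\{\sum_{i=1}^n a_ia_i^*: n\in\mathbb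 N,\ a_i\in\mathcal A_{x_i,\mathbbm 1}\text{ for some }x_i\in\mathrm{Irr}\}\subseteq\mathbb C[\mathcal C]$. *)

theory Defs
  imports Complex_Main "HOL-Library.Function_Algebras" "HOL-Library.Countable_Set"
begin

text \<open>
  The objects are the elements of the type \<open>'o\<close>, and the morphism spaces \<open>Hom C x y\<close> are
  linear subspaces of one ambient complex vector space \<open>'m\<close>; the operations on morphisms are only
  constrained on these subspaces. This is no restriction: for a given (small) category take \<open>'m\<close> to
  be the direct sum of all its morphism spaces.  The subspaces then meet only in \<open>0\<close>, where linearity
  makes all the operations agree.
\<close>

record ('o, 'm) cstar_tensor_data =
  scale :: "complex \<Rightarrow> 'm \<Rightarrow> 'm"  (infixr "\<star>\<index>" 75)
  Hom :: "'o \<Rightarrow> 'o \<Rightarrow> 'm set"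
  ident :: "'o \<Rightarrow> 'm"
  compose :: "'m \<Rightarrow> 'm \<Rightarrow> 'm"  (infixl "\<cdot>\<index>" 65)
  adjoint :: "'m \<Rightarrow> 'm"  ("_\<dagger>\<index>" [1000] 1000)
  hom_norm :: "'m \<Rightarrow> real"
  unit_ob :: "'o"
  tensor_ob :: "'o \<Rightarrow> 'o \<Rightarrow> 'o"  (infixl "\<otimes>\<index>" 70)
  tensor :: "'m \<Rightarrow> 'm \<Rightarrow> 'm"  (infixl "\<boxtimes>\<index>" 70)

locale cstar_category = vector_space "scale C"
  for C :: "('o, 'm::ab_group_add, 'z) cstar_tensor_data_scheme" (structure) +
  assumes subspace_Hom: "subspace (Hom C x y)"
    and ident_in_Hom: "ident C x \<in> Hom C x x"
    and compose_in_Hom: "\<lbrakk>g \<in> Hom C y z; f \<in> Hom C x y\<rbrakk> \<Longrightarrow> g \<cdot> f \<in> Hom C x z"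
    and compose_assoc:
      "\<lbrakk>h \<in> Hom C z w; g \<in> Hom C y z; f \<in> Hom C x y\<rbrakk> \<Longrightarrow> h \<cdot> g \<cdot> f = h \<cdot> (g \<cdot> f)"
    and ident_compose: "f \<in> Hom C x y \<Longrightarrow> ident C y \<cdot> f = f"
    and compose_ident: "f \<in> Hom C x y \<Longrightarrow> f \<cdot> ident C x = f"
    and compose_add_left:
      "\<lbrakk>g \<in> Hom C y z; g' \<in> Hom C y z; f \<in> Hom C x y\<rbrakk> \<Longrightarrow> (g + g') \<cdot> f = (g \<cdot> f) + (g' \<cdot> f)"
    and compose_add_right:
      "\<lbrakk>g \<in> Hom C y z; f \<in> Hom C x y; f' \<in> Hom C x y\<rbrakk> \<Longrightarrow> g \<cdot> (f + f') = (g \<cdot> f) + (g \<cdot> f')"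
    and compose_scale_left:
      "\<lbrakk>g \<in> Hom C y z; f \<in> Hom C x y\<rbrakk> \<Longrightarrow> (c \<star> g) \<cdot> f = c \<star> (g \<cdot> f)"
    and compose_scale_right:
      "\<lbrakk>g \<in> Hom C y z; f \<in> Hom C x y\<rbrakk> \<Longrightarrow> g \<cdot> (c \<star> f) = c \<star> (g \<cdot> f)"
    and adjoint_in_Hom: "f \<in> Hom C x y \<Longrightarrow> f\<dagger> \<in> Hom C y x"
    and adjoint_adjoint: "f \<in> Hom C x y \<Longrightarrow> f\<dagger>\<dagger> = f"
    and adjoint_compose: "\<lbrakk>g \<in> Hom C y z; f \<in> Hom C x y\<rbrakk> \<Longrightarrow> (g \<cdot> f)\<dagger> = f\<dagger> \<cdot> g\<dagger>"
    and adjoint_add: "\<lbrakk>f \<in> Hom C x y; f' \<in> Hom C x y\<rbrakk> \<Longrightarrow> (f + f')\<dagger> = f\<dagger> + f'\<dagger>"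
    and adjoint_scale: "f \<in> Hom C x y \<Longrightarrow> (c \<star> f)\<dagger> = cnj c \<star> f\<dagger>"
    and norm_eq_0_iff: "f \<in> Hom C x y \<Longrightarrow> hom_norm C f = 0 \<longleftrightarrow> f = 0"
    and norm_triangle:
      "\<lbrakk>f \<in> Hom C x y; f' \<in> Hom C x y\<rbrakk> \<Longrightarrow> hom_norm C (f + f') \<le> hom_norm C f + hom_norm C f'"
    and norm_scale: "f \<in> Hom C x y \<Longrightarrow> hom_norm C (c \<star> f) = cmod c * hom_norm C f"
    and norm_complete:
      "\<lbrakk>\<And>n. X n \<in> Hom C x y;
        \<And>e. e > 0 \<Longrightarrow> \<exists>N. \<forall>m\<ge>N. \<forall>n\<ge>N. hom_norm C (X m - X n) < e\<rbrakk>
       \<Longrightarrow> \<exists>L\<in>Hom C x y. (\<lambda>n::nat. hom_norm C (X n - L)) \<longlonglongrightarrow> 0"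
    and norm_compose:
      "\<lbrakk>g \<in> Hom C y z; f \<in> Hom C x y\<rbrakk> \<Longrightarrow> hom_norm C (g \<cdot> f) \<le> hom_norm C g * hom_norm C f"
    and norm_adjoint_compose: "f \<in> Hom C x y \<Longrightarrow> hom_norm C (f\<dagger> \<cdot> f) = (hom_norm C f)\<^sup>2"
    \<comment> \<open>\<open>f\<dagger> \<cdot> f\<close> is a positive element of the C*-algebra \<open>Hom C x x\<close>\<close>
    and adjoint_compose_positive: "f \<in> Hom C x y \<Longrightarrow> \<exists>h\<in>Hom C x x. f\<dagger> \<cdot> f = h\<dagger> \<cdot> h"

locale cstar_tensor_category = cstar_category C
  for C :: "('o, 'm::ab_group_add, 'z) cstar_tensor_data_scheme" (structure) +
  assumes tensor_ob_assoc: "(x \<otimes> y) \<otimes> z = x \<otimes> (y \<otimes> z)"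
    and unit_tensor_ob: "unit_ob C \<otimes> x = x"
    and tensor_ob_unit: "x \<otimes> unit_ob C = x"
    and tensor_in_Hom:
      "\<lbrakk>f \<in> Hom C x y; g \<in> Hom C x' y'\<rbrakk> \<Longrightarrow> f \<boxtimes> g \<in> Hom C (x \<otimes> x') (y \<otimes> y')"
    and tensor_ident: "ident C x \<boxtimes> ident C y = ident C (x \<otimes> y)"
    and tensor_compose:
      "\<lbrakk>g \<in> Hom C y z; f \<in> Hom C x y; g' \<in> Hom C y' z'; f' \<in> Hom C x' y'\<rbrakk>
       \<Longrightarrow> (g \<cdot> f) \<boxtimes> (g' \<cdot> f') = (g \<boxtimes> g') \<cdot> (f \<boxtimes> f')"
    and tensor_assoc:
      "\<lbrakk>f \<in> Hom C x y; g \<in> Hom C x' y'; h \<in> Hom C x'' y''\<rbrakk> \<Longrightarrow> (f \<boxtimes> g) \<boxtimes> h = f \<boxtimes> (g \<boxtimes> h)"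
    and unit_tensor: "f \<in> Hom C x y \<Longrightarrow> ident C (unit_ob C) \<boxtimes> f = f"
    and tensor_unit: "f \<in> Hom C x y \<Longrightarrow> f \<boxtimes> ident C (unit_ob C) = f"
    and tensor_add_left:
      "\<lbrakk>f \<in> Hom C x y; f' \<in> Hom C x y; g \<in> Hom C x' y'\<rbrakk> \<Longrightarrow> (f + f') \<boxtimes> g = f \<boxtimes> g + f' \<boxtimes> g"
    and tensor_add_right:
      "\<lbrakk>f \<in> Hom C x y; g \<in> Hom C x' y'; g' \<in> Hom C x' y'\<rbrakk> \<Longrightarrow> f \<boxtimes> (g + g') = f \<boxtimes> g + f \<boxtimes> g'"
    and tensor_scale_left:
      "\<lbrakk>f \<in> Hom C x y; g \<in> Hom C x' y'\<rbrakk> \<Longrightarrow> (c \<star> f) \<boxtimes> g = c \<star> (f \<boxtimes> g)"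
    and tensor_scale_right:
      "\<lbrakk>f \<in> Hom C x y; g \<in> Hom C x' y'\<rbrakk> \<Longrightarrow> f \<boxtimes> (c \<star> g) = c \<star> (f \<boxtimes> g)"
    and adjoint_tensor:
      "\<lbrakk>f \<in> Hom C x y; g \<in> Hom C x' y'\<rbrakk> \<Longrightarrow> (f \<boxtimes> g)\<dagger> = f\<dagger> \<boxtimes> g\<dagger>"
    and direct_sums:
      "\<exists>z. \<exists>u\<in>Hom C x z. \<exists>v\<in>Hom C y z.
         u\<dagger> \<cdot> u = ident C x \<and> v\<dagger> \<cdot> v = ident C y \<and> (u \<cdot> u\<dagger>) + (v \<cdot> v\<dagger>) = ident C z"
    \<comment> \<open>For \<open>p = 0\<close> this yields a zero object, i.e. the empty direct sum.\<close>
    and subobjects: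
      "\<lbrakk>p \<in> Hom C x x; p \<cdot> p = p; p\<dagger> = p\<rbrakk>
       \<Longrightarrow> \<exists>y. \<exists>v\<in>Hom C y x. v\<dagger> \<cdot> v = ident C y \<and> v \<cdot> v\<dagger> = p"

definition simple :: "('o, 'm::ab_group_add, 'z) cstar_tensor_data_scheme \<Rightarrow> 'o \<Rightarrow> bool" where
  "simple C x \<longleftrightarrow> ident C x \<noteq> 0 \<and> Hom C x x = range (\<lambda>c. scale C c (ident C x))"

definition isomorphic ::
  "('o, 'm::ab_group_add, 'z) cstar_tensor_data_scheme \<Rightarrow> 'o \<Rightarrow> 'o \<Rightarrow> bool" where
  "isomorphic C x y \<longleftrightarrow>
     (\<exists>f\<in>Hom C x y. \<exists>g\<in>Hom C y x. compose C g f = ident C x \<and> compose C f g = ident C y)"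

definition simple_iso_classes ::
  "('o, 'm::ab_group_add, 'z) cstar_tensor_data_scheme \<Rightarrow> 'o set set" where
  "simple_iso_classes C =
     {x. simple C x} // {(x, y). simple C x \<and> simple C y \<and> isomorphic C x y}"

definition conjugate_solution ::
  "('o, 'm::ab_group_add, 'z) cstar_tensor_data_scheme \<Rightarrow> 'o \<Rightarrow> 'o \<Rightarrow> 'm \<Rightarrow> 'm \<Rightarrow> bool" where
  "conjugate_solution C x xb R Rb \<longleftrightarrow>
     R \<in> Hom C (unit_ob C) (xb \<otimes> x) \<and> Rb \<in> Hom C (unit_ob C) (x \<otimes> xb) \<and>
     (ident C xb \<boxtimes> Rb\<dagger>) \<cdot> (R \<boxtimes> ident C xb) = ident C xb \<and>
     (ident C x \<boxtimes> R\<dagger>) \<cdot> (Rb \<boxtimes> ident C x) = ident C x"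
  for C (structure)

definition standard_solution ::
  "('o, 'm::ab_group_add, 'z) cstar_tensor_data_scheme \<Rightarrow> 'o \<Rightarrow> 'o \<Rightarrow> 'm \<Rightarrow> 'm \<Rightarrow> bool" where
  "standard_solution C x xb R Rb \<longleftrightarrow>
     conjugate_solution C x xb R Rb \<and>
     (\<forall>f\<in>Hom C x x. R\<dagger> \<cdot> (ident C xb \<boxtimes> f) \<cdot> R = Rb\<dagger> \<cdot> (f \<boxtimes> ident C xb) \<cdot> Rb)"
  for C (structure)

locale rigid_cstar_tensor_category = cstar_tensor_category C
  for C :: "('o, 'm::ab_group_add, 'z) cstar_tensor_data_scheme" (structure) +
  assumes rigid: "\<exists>xb R Rb. conjugate_solution C x xb R Rb"

text \<open>
  The choices on which the tube algebra depends: representatives of the simple objects, and standard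
  solutions of the conjugate equations.
\<close>

record ('o, 'm) tube_data = "('o, 'm) cstar_tensor_data" +
  Irr :: "'o set"
  conj_ob :: "'o \<Rightarrow> 'o"
  std_R :: "'o \<Rightarrow> 'm"
  std_Rbar :: "'o \<Rightarrow> 'm"

definition simple_representatives :: "('o, 'm::ab_group_add, 'z) tube_data_scheme \<Rightarrow> bool" where
  "simple_representatives C \<longleftrightarrow>
     Irr C \<subseteq> {x. simple C x} \<and> unit_ob C \<in> Irr C \<and>
     (\<forall>x. simple C x \<longrightarrow> (\<exists>!y. y \<in> Irr C \<and> isomorphic C x y))"

definition standard_choice :: "('o, 'm::ab_group_add, 'z) tube_data_scheme \<Rightarrow> bool" where
  "standard_choice C \<longleftrightarrow>
     (\<forall>x. standard_solution C x (conj_ob C x) (std_R C x) (std_Rbar C x))"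

text \<open>
  An element \<open>a\<close> of the tube algebra is the family of its components
  \<open>a x y w\<close> in \<open>Hom C (w \<otimes> x) (y \<otimes> w)\<close>, extended by \<open>0\<close> outside of \<open>Irr C\<close>.
\<close>

definition tube_support :: "('o \<Rightarrow> 'o \<Rightarrow> 'o \<Rightarrow> 'm::ab_group_add) \<Rightarrow> ('o \<times> 'o \<times> 'o) set" where
  "tube_support a = {(x, y, w). a x y w \<noteq> 0}"

definition tube_algebra ::
  "('o, 'm::ab_group_add, 'z) tube_data_scheme \<Rightarrow> ('o \<Rightarrow> 'o \<Rightarrow> 'o \<Rightarrow> 'm) set" where
  "tube_algebra C =
     {a. finite (tube_support a) \<and> tube_support a \<subseteq> Irr C \<times> Irr C \<times> Irr C \<and>
         (\<forall>x\<in>Irr C. \<forall>y\<in>Irr C. \<forall>w\<in>Irr C. a x y w \<in> Hom C (w \<otimes> x) (y \<otimes> w))}"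
  for C (structure)

definition tube_space ::
  "('o, 'm::ab_group_add, 'z) tube_data_scheme \<Rightarrow> 'o \<Rightarrow> 'o \<Rightarrow> ('o \<Rightarrow> 'o \<Rightarrow> 'o \<Rightarrow> 'm) set" where
  "tube_space C x y = {a \<in> tube_algebra C. tube_support a \<subseteq> {x} \<times> {y} \<times> UNIV}"

definition hom_inner ::
  "('o, 'm::ab_group_add, 'z) cstar_tensor_data_scheme \<Rightarrow> 'o \<Rightarrow> 'm \<Rightarrow> 'm \<Rightarrow> complex" where
  "hom_inner C w \<sigma> \<tau> = (THE c. \<tau>\<dagger> \<cdot> \<sigma> = c \<star> ident C w)"
  for C (structure)

definition hom_orthonormal_basis ::
  "('o, 'm::ab_group_add, 'z) cstar_tensor_data_scheme \<Rightarrow> 'o \<Rightarrow> 'o \<Rightarrow> 'm set \<Rightarrow> bool" where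
  "hom_orthonormal_basis C w z B \<longleftrightarrow>
     finite B \<and> B \<subseteq> Hom C w z \<and> module.span (scale C) B = Hom C w z \<and>
     (\<forall>\<alpha>\<in>B. \<forall>\<beta>\<in>B. hom_inner C w \<alpha> \<beta> = (if \<alpha> = \<beta> then 1 else 0))"

definition tube_Psi ::
  "('o, 'm::ab_group_add, 'z) tube_data_scheme \<Rightarrow> 'o \<Rightarrow> 'o \<Rightarrow> 'o \<Rightarrow> 'm \<Rightarrow> ('o \<Rightarrow> 'o \<Rightarrow> 'o \<Rightarrow> 'm)" where
  "tube_Psi C z x y \<gamma> =
     (\<lambda>x' y' w. if x' = x \<and> y' = y \<and> w \<in> Irr C
        then \<Sum>\<alpha>\<in>(SOME B. hom_orthonormal_basis C w z B).
               (ident C y \<boxtimes> \<alpha>\<dagger>) \<cdot> \<gamma> \<cdot> (\<alpha> \<boxtimes> ident C x)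
        else 0)"
  for C (structure)

text \<open>
  The product and the involution are determined by
    \<open>\<Psi>(z1,x1,y1,\<gamma>1) \<Psi>(z2,x2,y2,\<gamma>2) = \<delta>(x1,y2) \<Psi>(z1 \<otimes> z2, x2, y1, (\<gamma>1 \<boxtimes> 1) \<cdot> (1 \<boxtimes> \<gamma>2))\<close> and
    \<open>\<Psi>(z,x,y,\<gamma>)* = \<Psi>(zbar, y, x, (R(z)\<dagger> \<boxtimes> 1 \<boxtimes> 1) \<cdot> (1 \<boxtimes> \<gamma>\<dagger> \<boxtimes> 1) \<cdot> (1 \<boxtimes> 1 \<boxtimes> Rbar(z)))\<close>
  for arbitrary objects \<open>z\<close>.  For \<open>w\<close> in \<open>Irr C\<close> the element \<open>\<Psi>(w,x,y,\<gamma>)\<close> is \<open>\<gamma>\<close> itself, placed in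
  the summand \<open>Hom C (w \<otimes> x) (y \<otimes> w)\<close>; so every \<open>a\<close> is the finite sum of the
  \<open>\<Psi>(w, x, y, a x y w)\<close>, and since the operations are (bi)additive, the definitions below apply
  the two formulas to these summands.
\<close>

definition tube_mult ::
  "('o, 'm::ab_group_add, 'z) tube_data_scheme \<Rightarrow>
     ('o \<Rightarrow> 'o \<Rightarrow> 'o \<Rightarrow> 'm) \<Rightarrow> ('o \<Rightarrow> 'o \<Rightarrow> 'o \<Rightarrow> 'm) \<Rightarrow> ('o \<Rightarrow> 'o \<Rightarrow> 'o \<Rightarrow> 'm)" where
  "tube_mult C a b =
     (\<Sum>(x1, y1, w1)\<in>tube_support a. \<Sum>(x2, y2, w2)\<in>tube_support b.
        if x1 = y2
        then tube_Psi C (w1 \<otimes> w2) x2 y1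
               ((a x1 y1 w1 \<boxtimes> ident C w2) \<cdot> (ident C w1 \<boxtimes> b x2 y2 w2))
        else 0)"
  for C (structure)

definition tube_star ::
  "('o, 'm::ab_group_add, 'z) tube_data_scheme \<Rightarrow>
     ('o \<Rightarrow> 'o \<Rightarrow> 'o \<Rightarrow> 'm) \<Rightarrow> ('o \<Rightarrow> 'o \<Rightarrow> 'o \<Rightarrow> 'm)" where
  "tube_star C a =
     (\<Sum>(x, y, w)\<in>tube_support a.
        tube_Psi C (conj_ob C w) y x
          (((std_R C w)\<dagger> \<boxtimes> ident C x \<boxtimes> ident C (conj_ob C w)) \<cdot>
           (ident C (conj_ob C w) \<boxtimes> (a x y w)\<dagger> \<boxtimes> ident C (conj_ob C w)) \<cdot>
           (ident C (conj_ob C w) \<boxtimes> ident C y \<boxtimes> std_Rbar C w)))"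
  for C (structure)

text \<open>
  The fusion algebra has basis \<open>Irr C\<close>: its elements are represented by their coefficient functions.
  It is identified with the corner \<open>tube_space C (unit_ob C) (unit_ob C)\<close> of the tube algebra by
  \<open>fusion_embed\<close>; the cone below depends on its linear structure only.
\<close>

definition fusion_algebra :: "('o, 'm::ab_group_add, 'z) tube_data_scheme \<Rightarrow> ('o \<Rightarrow> complex) set" where
  "fusion_algebra C = {f. finite {w. f w \<noteq> 0} \<and> {w. f w \<noteq> 0} \<subseteq> Irr C}"

definition fusion_embed ::
  "('o, 'm::ab_group_add, 'z) tube_data_scheme \<Rightarrow> ('o \<Rightarrow> complex) \<Rightarrow> ('o \<Rightarrow> 'o \<Rightarrow> 'o \<Rightarrow> 'm)" where
  "fusion_embed C f =
     (\<Sum>w | f w \<noteq> 0.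
        (\<lambda>x y v. scale C (f w) (tube_Psi C w (unit_ob C) (unit_ob C) (ident C w) x y v)))"

definition tube_cone :: "('o, 'm::ab_group_add, 'z) tube_data_scheme \<Rightarrow> ('o \<Rightarrow> complex) set" where
  "tube_cone C =
     {f \<in> fusion_algebra C. \<exists>(n::nat) a.
        (\<forall>i<n. \<exists>x\<in>Irr C. a i \<in> tube_space C x (unit_ob C)) \<and>
        fusion_embed C f = (\<Sum>i<n. tube_mult C (a i) (tube_star C (a i)))}"

end

theory Submission
  imports Defs
begin

text \<open>
  The cone is salient because the functional \<open>f \<mapsto> f \<one>\<close>, the coefficient at the unit object, is
  nonnegative on it and vanishes there only at \<open>0\<close>.  If \<open>f\<close> and \<open>- f\<close> both lie in the cone, then
  \<open>f \<one>\<close> and \<open>- f \<one>\<close> are both nonnegative, so \<open>f \<one> = 0\<close> and hence \<open>f = 0\<close>.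

  It suffices to consider one generator \<open>a a*\<close>, where \<open>a\<close> has the components \<open>k w\<close> in
  \<open>Hom C (w \<otimes> x) w\<close>.  Its coefficient at the unit is obtained by compressing
  \<open>(k u \<boxtimes> 1) \<cdot> (1 \<boxtimes> k w rotated)\<close> with isometries \<open>S\<close> from the unit to \<open>u \<otimes> conj_ob C w\<close>.
  By Frobenius reciprocity such an \<open>S\<close> exists only for \<open>u = w\<close>, and is then a multiple of
  \<open>std_Rbar C w\<close> (\<open>Hom_unit_conj\<close>).  The conjugate equations straighten the rotated morphism:
  composed with \<open>std_Rbar C w\<close>, it may be replaced by \<open>(k w)\<dagger>\<close> acting on the first tensor factor
  (\<open>rotation_Rbar\<close>).  Hence every contribution is a square \<open>G\<dagger> \<cdot> G\<close> with
  \<open>G = ((k w)\<dagger> \<boxtimes> 1) \<cdot> S\<close> (\<open>square_term\<close>), which is a nonnegative multiple of the identity of the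
  unit object.  By Frobenius reciprocity again, \<open>k w \<noteq> 0\<close> forces \<open>G \<noteq> 0\<close> for some \<open>S\<close>
  (\<open>gram_vector_nonzero\<close>), so the coefficient is \<open>0\<close> only for \<open>a = 0\<close>
  (\<open>unit_component_of_square\<close>).

  Numerically, \<open>k w \<cdot> (k w)\<dagger>\<close> is a multiple \<open>\<lambda> w\<close> of the identity of the simple object \<open>w\<close>, and
  the coefficient is the sum of the \<open>\<lambda> w\<close>.

  The isometries arise in two steps: the star of \<open>a\<close> is expanded over orthonormal bases of
  \<open>Hom C v (conj_ob C w)\<close> with \<open>v\<close> in \<open>Irr C\<close>, because \<open>conj_ob C w\<close> is in general only isomorphic
  to an element of \<open>Irr C\<close>; and the product over orthonormal bases of \<open>Hom C (unit_ob C) (u \<otimes> v)\<close>.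
  The sums run over bases picked by Hilbert choice, so one also has to know that finite orthonormal
  bases exist.  This is easy here: all the spaces involved have dimension at most one.
\<close>

section \<open>Morphisms out of simple objects in a C*-category\<close>

lemma sum_fun_apply: "(\<Sum>i\<in>A. f i) x = (\<Sum>i\<in>A. f i x)"
  by (induction A rule: infinite_finite_induct) auto

text \<open>The very basis over which the elements \<open>\<Psi>\<close> of the tube algebra are summed.\<close>

definition onb :: "('o, 'm::ab_group_add, 'z) cstar_tensor_data_scheme \<Rightarrow> 'o \<Rightarrow> 'o \<Rightarrow> 'm set" where
  "onb C w z = (SOME B. hom_orthonormal_basis C w z B)"

context cstar_category
begin

lemma zero_in_Hom [simp]: "0 \<in> Hom C x y"
  and scale_in_Hom: "f \<in> Hom C x y \<Longrightarrow> c \<star> f \<in> Hom C x y"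
  and sum_in_Hom: "(\<And>i. i \<in> A \<Longrightarrow> h i \<in> Hom C x y) \<Longrightarrow> sum h A \<in> Hom C x y"
  using subspace_Hom[of x y]
  by (auto intro: subspace_0 subspace_scale subspace_sum)

lemma compose_zero_right: "g \<in> Hom C y z \<Longrightarrow> g \<cdot> 0 = 0"
  using compose_scale_right[of g y z 0 y 0] by simp

lemma compose_zero_left: "f \<in> Hom C x y \<Longrightarrow> 0 \<cdot> f = 0"
  using compose_scale_left[of 0 y y f x 0] by simp

lemma adjoint_zero: "0\<dagger> = 0"
  using adjoint_scale[of 0 x x 0] by simp

lemma compose_sum_right:
  assumes g: "g \<in> Hom C y z" and h: "\<And>i. i \<in> A \<Longrightarrow> h i \<in> Hom C x y"
  shows "g \<cdot> (\<Sum>i\<in>A. h i) = (\<Sum>i\<in>A. g \<cdot> h i)"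
  using h
proof (induction A rule: infinite_finite_induct)
  case (insert i A)
  then show ?case
    using compose_add_right[OF g, of "h i" x "sum h A"] sum_in_Hom[of A h x y] by simp
qed (simp_all add: compose_zero_right[OF g])

lemma compose_sum_left:
  assumes f: "f \<in> Hom C x y" and h: "\<And>i. i \<in> A \<Longrightarrow> h i \<in> Hom C y z"
  shows "(\<Sum>i\<in>A. h i) \<cdot> f = (\<Sum>i\<in>A. h i \<cdot> f)"
  using h
proof (induction A rule: infinite_finite_induct)
  case (insert i A)
  then show ?case
    using compose_add_left[OF _ _ f, of "h i" z "sum h A"] sum_in_Hom[of A h y z] by simp
qed (simp_all add: compose_zero_left[OF f])

lemma adjoint_ident: "(ident C x)\<dagger> = ident C x"
  by (metis adjoint_adjoint adjoint_compose adjoint_in_Hom compose_ident ident_in_Hom)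

lemma simple_ident_nonzero: "simple C x \<Longrightarrow> ident C x \<noteq> 0"
  by (simp add: simple_def)

lemma simple_endomorphism:
  assumes "simple C x" "f \<in> Hom C x x"
  obtains c where "f = c \<star> ident C x"
  using assms unfolding simple_def by blast

lemma adjoint_compose_self_eq_0:
  assumes "f \<in> Hom C x y" "f\<dagger> \<cdot> f = 0"
  shows "f = 0"
proof -
  have "hom_norm C (0::'m) = 0" using norm_eq_0_iff[of 0 x x] by simp
  then have "(hom_norm C f)\<^sup>2 = 0" using norm_adjoint_compose[OF assms(1)] assms(2) by simp
  then show ?thesis using norm_eq_0_iff[OF assms(1)] by simp
qed

text \<open>
  Positivity of \<open>f\<dagger> \<cdot> f\<close> in \<open>Hom C x x\<close> becomes positivity of a number: writing
  \<open>f\<dagger> \<cdot> f = h\<dagger> \<cdot> h\<close> with an endomorphism \<open>h = c \<star> ident C x\<close> gives the number \<open>\<bar>c\<bar>\<^sup>2\<close>. It vanishes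
  only for \<open>f = 0\<close> by the C*-identity.
\<close>

lemma adjoint_compose_self_simple:
  assumes "simple C x" "f \<in> Hom C x y"
  obtains r where "r \<ge> 0" "f\<dagger> \<cdot> f = complex_of_real r \<star> ident C x" "r = 0 \<longleftrightarrow> f = 0"
proof -
  obtain h where h: "h \<in> Hom C x x" "f\<dagger> \<cdot> f = h\<dagger> \<cdot> h"
    using adjoint_compose_positive[OF assms(2)] by blast
  obtain c where c: "h = c \<star> ident C x" using simple_endomorphism[OF assms(1) h(1)] .
  have i: "ident C x \<in> Hom C x x" by (rule ident_in_Hom)
  have "h\<dagger> \<cdot> h = (cnj c * c) \<star> ident C x"
    unfolding c
    by (simp add: adjoint_scale[OF i] adjoint_ident compose_scale_left[OF i scale_in_Hom[OF i]]
        compose_scale_right[OF i i] ident_compose[OF i])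
  also have "cnj c * c = complex_of_real ((cmod c)\<^sup>2)"
    by (metis complex_norm_square mult.commute)
  finally have eq: "f\<dagger> \<cdot> f = complex_of_real ((cmod c)\<^sup>2) \<star> ident C x" using h(2) by simp
  moreover have "f = 0 \<Longrightarrow> (cmod c)\<^sup>2 = 0"
    using eq simple_ident_nonzero[OF assms(1)] compose_zero_right[OF adjoint_in_Hom[OF assms(2)]]
    by auto
  moreover have "(cmod c)\<^sup>2 = 0 \<Longrightarrow> f = 0"
    using eq adjoint_compose_self_eq_0[OF assms(2)] by simp
  ultimately show ?thesis using that[of "(cmod c)\<^sup>2"] by auto
qed

lemma hom_inner_eqI:
  assumes "simple C w" "\<tau>\<dagger> \<cdot> \<sigma> = c \<star> ident C w"
  shows "hom_inner C w \<sigma> \<tau> = c"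
  unfolding hom_inner_def assms(2)
  using simple_ident_nonzero[OF assms(1)] by auto

lemma orthonormal_basis_isometry:
  assumes "simple C w" "hom_orthonormal_basis C w z B" "\<alpha> \<in> B"
  shows "\<alpha>\<dagger> \<cdot> \<alpha> = ident C w"
proof -
  have "\<alpha> \<in> Hom C w z" "hom_inner C w \<alpha> \<alpha> = 1"
    using assms(2,3) by (auto simp: hom_orthonormal_basis_def)
  then show ?thesis
    using hom_inner_eqI[OF assms(1), of \<alpha> \<alpha>] adjoint_compose_self_simple[OF assms(1)]
    by (metis scale_one)
qed

text \<open>
  A nonzero spanning vector can be normalized; if \<open>f = 0\<close>, the basis is empty. The conclusion is
  about the chosen basis, which is some orthonormal basis as soon as there is one.
\<close>

lemma orthonormal_basis_of_line:
  assumes w: "simple C w" and f: "f \<in> Hom C w z" and line: "Hom C w z = range (\<lambda>c. c \<star> f)"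
  shows "hom_orthonormal_basis C w z (onb C w z)"
proof -
  have "\<exists>B. hom_orthonormal_basis C w z B"
  proof (cases "f = 0")
    case True
    then have "hom_orthonormal_basis C w z {}"
      using line by (auto simp: hom_orthonormal_basis_def span_empty)
    then show ?thesis ..
  next
    case False
    obtain r where r: "r \<ge> 0" "f\<dagger> \<cdot> f = complex_of_real r \<star> ident C w" "r = 0 \<longleftrightarrow> f = 0"
      using adjoint_compose_self_simple[OF w f] .
    define s where "s = complex_of_real (1 / sqrt r)"
    have "r > 0" using r False by auto
    then have s: "s \<noteq> 0" "cnj s * s * complex_of_real r = 1"
      by (auto simp: s_def simp flip: of_real_mult)
    have sf: "s \<star> f \<in> Hom C w z" using f by (rule scale_in_Hom)
    have "(s \<star> f)\<dagger> \<cdot> (s \<star> f) = (cnj s * s * complex_of_real r) \<star> ident C w"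
      using r(2) by (simp add: adjoint_scale[OF f] compose_scale_right[OF _ f]
          compose_scale_left[OF adjoint_in_Hom[OF f] sf] 
          compose_scale_right[OF adjoint_in_Hom[OF f] f] mult.commute)
    then have "hom_inner C w (s \<star> f) (s \<star> f) = 1"
      using hom_inner_eqI[OF w] s(2) by metis
    moreover have "span {s \<star> f} = Hom C w z"
      unfolding line span_singleton
    proof (intro equalityI subsetI; elim rangeE)
      fix g c assume "g = c \<star> (s \<star> f)"
      then show "g \<in> range (\<lambda>c. c \<star> f)" by auto
    next
      fix g c assume "g = c \<star> f"
      then have "g = (c / s) \<star> (s \<star> f)" using s(1) by simp
      then show "g \<in> range (\<lambda>k. k \<star> (s \<star> f))" by blast
    qed
    ultimately have "hom_orthonormal_basis C w z {s \<star> f}"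
      using sf by (auto simp: hom_orthonormal_basis_def)
    then show ?thesis ..
  qed
  then show ?thesis unfolding onb_def by (rule someI_ex)
qed

text \<open>
  Both \<open>f\<dagger> \<cdot> f\<close> and \<open>f \<cdot> f\<dagger>\<close> are scalars, and evaluating \<open>f \<cdot> f\<dagger> \<cdot> f\<close> in two ways shows that the
  scalars agree. So \<open>f\<close> is a multiple of a unitary.
\<close>

lemma schur:
  assumes x: "simple C x" and y: "simple C y" and f: "f \<in> Hom C x y" "f \<noteq> 0"
  obtains r where "r > 0" "f\<dagger> \<cdot> f = complex_of_real r \<star> ident C x"
    "f \<cdot> f\<dagger> = complex_of_real r \<star> ident C y"
proof -
  note f' = adjoint_in_Hom[OF f(1)]
  obtain r where r: "r \<ge> 0" "f\<dagger> \<cdot> f = complex_of_real r \<star> ident C x" "r = 0 \<longleftrightarrow> f = 0"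
    using adjoint_compose_self_simple[OF x f(1)] .
  obtain s where s: "f \<cdot> f\<dagger> = s \<star> ident C y"
    using simple_endomorphism[OF y compose_in_Hom[OF f(1) f']] .
  have "complex_of_real r \<star> f = f \<cdot> (f\<dagger> \<cdot> f)"
    unfolding r(2) using compose_scale_right[OF f(1) ident_in_Hom] compose_ident[OF f(1)] by simp
  also have "\<dots> = (f \<cdot> f\<dagger>) \<cdot> f" using compose_assoc[OF f(1) f' f(1)] by simp
  also have "\<dots> = s \<star> f"
    unfolding s using compose_scale_left[OF ident_in_Hom f(1)] ident_compose[OF f(1)] by simp
  finally have "s = complex_of_real r" using f(2) scale_right_imp_eq by metis
  then show ?thesis using that[OF _ r(2)] r(1,3) s f(2) by auto
qed

lemma simple_nonzero_isomorphic:
  assumes "simple C x" "simple C y" "f \<in> Hom C x y" "f \<noteq> 0"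
  shows "isomorphic C x y"
proof -
  obtain r where r: "r > 0" "f\<dagger> \<cdot> f = complex_of_real r \<star> ident C x"
    "f \<cdot> f\<dagger> = complex_of_real r \<star> ident C y" using schur[OF assms] .
  note f' = adjoint_in_Hom[OF assms(3)]
  let ?g = "complex_of_real (1 / r) \<star> f\<dagger>"
  have "?g \<cdot> f = ident C x" "f \<cdot> ?g = ident C y"
    using r by (simp_all add: compose_scale_left[OF f' assms(3)] compose_scale_right[OF assms(3) f'])
  then show ?thesis unfolding isomorphic_def using assms(3) scale_in_Hom[OF f'] by blast
qed

lemma schur_line:
  assumes x: "simple C x" and y: "simple C y"
  obtains f where "f \<in> Hom C x y" "Hom C x y = range (\<lambda>c. c \<star> f)"
proof (cases "\<exists>f\<in>Hom C x y. f \<noteq> 0")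
  case False
  then have "Hom C x y = range (\<lambda>c. c \<star> 0)" by auto
  then show ?thesis using that[of 0] by simp
next
  case True
  then obtain f where f: "f \<in> Hom C x y" "f \<noteq> 0" by blast
  note f' = adjoint_in_Hom[OF f(1)]
  obtain r where r: "r > 0" "f \<cdot> f\<dagger> = complex_of_real r \<star> ident C y" using schur[OF x y f] .
  have "g \<in> range (\<lambda>c. c \<star> f)" if g: "g \<in> Hom C x y" for g
  proof -
    obtain c where c: "f\<dagger> \<cdot> g = c \<star> ident C x"
      using simple_endomorphism[OF x compose_in_Hom[OF f' g]] .
    have "complex_of_real r \<star> g = (f \<cdot> f\<dagger>) \<cdot> g"
      unfolding r(2) using compose_scale_left[OF ident_in_Hom g] ident_compose[OF g] by simp
    also have "\<dots> = f \<cdot> (f\<dagger> \<cdot> g)" by (rule compose_assoc[OF f(1) f' g])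
    also have "\<dots> = c \<star> f"
      unfolding c using compose_scale_right[OF f(1) ident_in_Hom] compose_ident[OF f(1)] by simp
    finally have "complex_of_real (1/r) \<star> (complex_of_real r \<star> g) = complex_of_real (1/r) \<star> (c \<star> f)"
      by simp
    then have "g = (complex_of_real (1/r) * c) \<star> f" using r(1) by simp
    then show ?thesis by blast
  qed
  then have "Hom C x y = range (\<lambda>c. c \<star> f)" using scale_in_Hom[OF f(1)] by auto
  then show ?thesis using that f(1) by blast
qed

end

section \<open>Frobenius reciprocity and conjugates of simple objects\<close>

context cstar_tensor_category
begin

lemma tensor_compose_ident_left:
  assumes "g \<in> Hom C y z" "f \<in> Hom C x y"
  shows "ident C u \<boxtimes> (g \<cdot> f) = (ident C u \<boxtimes> g) \<cdot> (ident C u \<boxtimes> f)"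
  using tensor_compose[OF ident_in_Hom[of u] ident_in_Hom assms] ident_compose[OF ident_in_Hom[of u]]
  by simp

lemma tensor_compose_ident_right:
  assumes "g \<in> Hom C y z" "f \<in> Hom C x y"
  shows "(g \<cdot> f) \<boxtimes> ident C u = (g \<boxtimes> ident C u) \<cdot> (f \<boxtimes> ident C u)"
  using tensor_compose[OF assms ident_in_Hom[of u] ident_in_Hom] ident_compose[OF ident_in_Hom[of u]]
  by simp

text \<open>The interchange law: morphisms on different tensor factors slide past each other.\<close>

lemma tensor_left_then:
  assumes "f \<in> Hom C x y" "g \<in> Hom C x' y'"
  shows "(f \<boxtimes> ident C y') \<cdot> (ident C x \<boxtimes> g) = f \<boxtimes> g"
    and "(ident C y \<boxtimes> g) \<cdot> (f \<boxtimes> ident C x') = f \<boxtimes> g"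
  using tensor_compose[OF assms(1) ident_in_Hom ident_in_Hom assms(2)]
    tensor_compose[OF ident_in_Hom assms(1) assms(2) ident_in_Hom]
    compose_ident[OF assms(1)] ident_compose[OF assms(1)]
    compose_ident[OF assms(2)] ident_compose[OF assms(2)] by simp_all

lemma tensor_zero_left: "g \<in> Hom C x' y' \<Longrightarrow> 0 \<boxtimes> g = 0"
  using tensor_scale_left[of 0 x' x' g x' y' 0] by simp

lemma tensor_zero_right: "f \<in> Hom C x y \<Longrightarrow> f \<boxtimes> 0 = 0"
  using tensor_scale_right[of f x y 0 x x 0] by simp

lemma tensor_sum_right:
  assumes f: "f \<in> Hom C x y" and h: "\<And>i. i \<in> A \<Longrightarrow> h i \<in> Hom C x' y'"
  shows "f \<boxtimes> (\<Sum>i\<in>A. h i) = (\<Sum>i\<in>A. f \<boxtimes> h i)"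
  using h
proof (induction A rule: infinite_finite_induct)
  case (insert i A)
  then show ?case
    using tensor_add_right[OF f, of "h i" x' y' "sum h A"] sum_in_Hom[of A h x' y'] by simp
qed (simp_all add: tensor_zero_right[OF f])

lemma conjugate_solution_sym:
  assumes "conjugate_solution C x xb R Rb"
  shows "conjugate_solution C xb x Rb R"
  using assms unfolding conjugate_solution_def by auto

lemma conjugate_equation_adjoint:
  assumes conj: "conjugate_solution C x xb R Rb"
  shows "(R\<dagger> \<boxtimes> ident C xb) \<cdot> (ident C xb \<boxtimes> Rb) = ident C xb"
proof -
  have R: "R \<in> Hom C (unit_ob C) (xb \<otimes> x)" and Rb: "Rb \<in> Hom C (unit_ob C) (x \<otimes> xb)"
    and eq: "(ident C xb \<boxtimes> Rb\<dagger>) \<cdot> (R \<boxtimes> ident C xb) = ident C xb"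
    using conj unfolding conjugate_solution_def by auto
  note i = ident_in_Hom
  have "((ident C xb \<boxtimes> Rb\<dagger>) \<cdot> (R \<boxtimes> ident C xb))\<dagger> = (R \<boxtimes> ident C xb)\<dagger> \<cdot> (ident C xb \<boxtimes> Rb\<dagger>)\<dagger>"
  proof (rule adjoint_compose)
    show "ident C xb \<boxtimes> Rb\<dagger> \<in> Hom C (xb \<otimes> x \<otimes> xb) xb"
      using tensor_in_Hom[OF i adjoint_in_Hom[OF Rb], of xb]
      by (simp add: tensor_ob_unit tensor_ob_assoc)
    show "R \<boxtimes> ident C xb \<in> Hom C xb (xb \<otimes> x \<otimes> xb)"
      using tensor_in_Hom[OF R i, of xb] by (simp add: unit_tensor_ob)
  qed
  then show ?thesis
    by (simp add: eq adjoint_ident adjoint_tensor[OF R i] adjoint_tensor[OF i adjoint_in_Hom[OF Rb]]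
        adjoint_adjoint[OF Rb])
qed

text \<open>
  Bending the leg \<open>xb\<close> down with \<open>R\<dagger>\<close> turns \<open>T\<close> into a morphism from \<open>x\<close> to \<open>y\<close>, and bending it up
  again with \<open>Rb\<close> gives back \<open>T\<close>, since \<open>(R\<dagger> \<boxtimes> 1) \<cdot> (1 \<boxtimes> Rb) = 1\<close>.
\<close>

lemma frobenius_unit:
  assumes conj: "conjugate_solution C x xb R Rb" and T: "T \<in> Hom C (unit_ob C) (y \<otimes> xb)"
  shows "(ident C y \<boxtimes> R\<dagger>) \<cdot> (T \<boxtimes> ident C x) \<in> Hom C x y"
    and "(((ident C y \<boxtimes> R\<dagger>) \<cdot> (T \<boxtimes> ident C x)) \<boxtimes> ident C xb) \<cdot> Rb = T"
proof -
  have R: "R \<in> Hom C (unit_ob C) (xb \<otimes> x)" and Rb: "Rb \<in> Hom C (unit_ob C) (x \<otimes> xb)"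
    and eq: "(ident C xb \<boxtimes> Rb\<dagger>) \<cdot> (R \<boxtimes> ident C xb) = ident C xb"
    using conj unfolding conjugate_solution_def by auto
  note i = ident_in_Hom
  have R': "R\<dagger> \<in> Hom C (xb \<otimes> x) (unit_ob C)" using R by (rule adjoint_in_Hom)
  have yR: "ident C y \<boxtimes> R\<dagger> \<in> Hom C (y \<otimes> xb \<otimes> x) y"
    using tensor_in_Hom[OF i R', of y] by (simp add: tensor_ob_unit tensor_ob_assoc)
  have Tx: "T \<boxtimes> ident C x \<in> Hom C x (y \<otimes> xb \<otimes> x)"
    using tensor_in_Hom[OF T i, of x] by (simp add: unit_tensor_ob)
  show "(ident C y \<boxtimes> R\<dagger>) \<cdot> (T \<boxtimes> ident C x) \<in> Hom C x y"
    using yR Tx by (rule compose_in_Hom)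
  have Txx: "(T \<boxtimes> ident C x) \<boxtimes> ident C xb \<in> Hom C (x \<otimes> xb) (y \<otimes> xb \<otimes> x \<otimes> xb)"
    using tensor_in_Hom[OF Tx i, of xb] by simp
  have yRx: "(ident C y \<boxtimes> R\<dagger>) \<boxtimes> ident C xb \<in> Hom C (y \<otimes> xb \<otimes> x \<otimes> xb) (y \<otimes> xb)"
    using tensor_in_Hom[OF yR i, of xb] by simp
  have "(((ident C y \<boxtimes> R\<dagger>) \<cdot> (T \<boxtimes> ident C x)) \<boxtimes> ident C xb) \<cdot> Rb
      = ((ident C y \<boxtimes> R\<dagger>) \<boxtimes> ident C xb) \<cdot> (((T \<boxtimes> ident C x) \<boxtimes> ident C xb) \<cdot> Rb)"
    unfolding tensor_compose_ident_right[OF yR Tx] by (rule compose_assoc[OF yRx Txx Rb])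
  also have "((T \<boxtimes> ident C x) \<boxtimes> ident C xb) \<cdot> Rb = (T \<boxtimes> ident C (x \<otimes> xb)) \<cdot> (ident C (unit_ob C) \<boxtimes> Rb)"
    using unit_tensor[OF Rb] tensor_assoc[OF T i i, of x xb] by (simp add: tensor_ident)
  also have "\<dots> = (ident C (y \<otimes> xb) \<boxtimes> Rb) \<cdot> T"
    using tensor_left_then[OF T Rb] tensor_unit[OF T] by simp
  also have "((ident C y \<boxtimes> R\<dagger>) \<boxtimes> ident C xb) \<cdot> ((ident C (y \<otimes> xb) \<boxtimes> Rb) \<cdot> T)
      = (((ident C y \<boxtimes> R\<dagger>) \<boxtimes> ident C xb) \<cdot> (ident C (y \<otimes> xb) \<boxtimes> Rb)) \<cdot> T"
  proof (rule compose_assoc[symmetric, OF yRx _ T])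
    show "ident C (y \<otimes> xb) \<boxtimes> Rb \<in> Hom C (y \<otimes> xb) (y \<otimes> xb \<otimes> x \<otimes> xb)"
      using tensor_in_Hom[OF i Rb, of "y \<otimes> xb"] by (simp add: tensor_ob_unit tensor_ob_assoc)
  qed
  also have "((ident C y \<boxtimes> R\<dagger>) \<boxtimes> ident C xb) \<cdot> (ident C (y \<otimes> xb) \<boxtimes> Rb)
      = (ident C y \<boxtimes> (R\<dagger> \<boxtimes> ident C xb)) \<cdot> (ident C y \<boxtimes> (ident C xb \<boxtimes> Rb))"
    using tensor_assoc[OF i R' i, of y xb] tensor_assoc[OF i i Rb, of y xb] by (simp add: tensor_ident)
  also have "\<dots> = ident C y \<boxtimes> ((R\<dagger> \<boxtimes> ident C xb) \<cdot> (ident C xb \<boxtimes> Rb))"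
  proof (rule tensor_compose_ident_left[symmetric])
    show "R\<dagger> \<boxtimes> ident C xb \<in> Hom C (xb \<otimes> x \<otimes> xb) xb"
      using tensor_in_Hom[OF R' i, of xb] by (simp add: unit_tensor_ob)
    show "ident C xb \<boxtimes> Rb \<in> Hom C xb (xb \<otimes> x \<otimes> xb)"
      using tensor_in_Hom[OF i Rb, of xb] by (simp add: tensor_ob_unit tensor_ob_assoc)
  qed
  also have "(R\<dagger> \<boxtimes> ident C xb) \<cdot> (ident C xb \<boxtimes> Rb) = ident C xb"
    by (rule conjugate_equation_adjoint[OF conj])
  finally show "(((ident C y \<boxtimes> R\<dagger>) \<cdot> (T \<boxtimes> ident C x)) \<boxtimes> ident C xb) \<cdot> Rb = T"
    using ident_compose[OF T] by (simp add: tensor_ident)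
qed

text \<open>The other composite of the two bending maps, straightened by the other conjugate equation.\<close>

lemma frobenius_back:
  assumes conj: "conjugate_solution C x xb R Rb" and X: "X \<in> Hom C x y"
  shows "(X \<boxtimes> ident C xb) \<cdot> Rb \<in> Hom C (unit_ob C) (y \<otimes> xb)"
    and "(ident C y \<boxtimes> R\<dagger>) \<cdot> (((X \<boxtimes> ident C xb) \<cdot> Rb) \<boxtimes> ident C x) = X"
proof -
  have R: "R \<in> Hom C (unit_ob C) (xb \<otimes> x)" and Rb: "Rb \<in> Hom C (unit_ob C) (x \<otimes> xb)"
    and eq: "(ident C x \<boxtimes> R\<dagger>) \<cdot> (Rb \<boxtimes> ident C x) = ident C x"
    using conj unfolding conjugate_solution_def by auto
  note i = ident_in_Hom
  have R': "R\<dagger> \<in> Hom C (xb \<otimes> x) (unit_ob C)" using R by (rule adjoint_in_Hom)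
  have Xx: "X \<boxtimes> ident C xb \<in> Hom C (x \<otimes> xb) (y \<otimes> xb)" by (rule tensor_in_Hom[OF X i])
  show "(X \<boxtimes> ident C xb) \<cdot> Rb \<in> Hom C (unit_ob C) (y \<otimes> xb)" using Xx Rb by (rule compose_in_Hom)
  have yR: "ident C y \<boxtimes> R\<dagger> \<in> Hom C (y \<otimes> xb \<otimes> x) y"
    using tensor_in_Hom[OF i R', of y] by (simp add: tensor_ob_unit tensor_ob_assoc)
  have xR: "ident C x \<boxtimes> R\<dagger> \<in> Hom C (x \<otimes> xb \<otimes> x) x"
    using tensor_in_Hom[OF i R', of x] by (simp add: tensor_ob_unit tensor_ob_assoc)
  have Rx: "Rb \<boxtimes> ident C x \<in> Hom C x (x \<otimes> xb \<otimes> x)"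
    using tensor_in_Hom[OF Rb i, of x] by (simp add: unit_tensor_ob)
  have Xxx: "X \<boxtimes> ident C (xb \<otimes> x) \<in> Hom C (x \<otimes> xb \<otimes> x) (y \<otimes> xb \<otimes> x)"
    using tensor_in_Hom[OF X i, of "xb \<otimes> x"] by (simp add: tensor_ob_assoc)
  have "((X \<boxtimes> ident C xb) \<cdot> Rb) \<boxtimes> ident C x = (X \<boxtimes> ident C (xb \<otimes> x)) \<cdot> (Rb \<boxtimes> ident C x)"
    using tensor_compose_ident_right[OF Xx Rb, of x] tensor_assoc[OF X i i, of xb x]
    by (simp add: tensor_ident)
  then have "(ident C y \<boxtimes> R\<dagger>) \<cdot> (((X \<boxtimes> ident C xb) \<cdot> Rb) \<boxtimes> ident C x)
      = ((ident C y \<boxtimes> R\<dagger>) \<cdot> (X \<boxtimes> ident C (xb \<otimes> x))) \<cdot> (Rb \<boxtimes> ident C x)"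
    using compose_assoc[OF yR Xxx Rx] by simp
  also have "(ident C y \<boxtimes> R\<dagger>) \<cdot> (X \<boxtimes> ident C (xb \<otimes> x)) = X \<cdot> (ident C x \<boxtimes> R\<dagger>)"
    using tensor_left_then[OF X R'] tensor_unit[OF X] by simp
  also have "\<dots> \<cdot> (Rb \<boxtimes> ident C x) = X"
    using compose_assoc[OF X xR Rx] compose_ident[OF X] eq by simp
  finally show "(ident C y \<boxtimes> R\<dagger>) \<cdot> (((X \<boxtimes> ident C xb) \<cdot> Rb) \<boxtimes> ident C x) = X" .
qed

text \<open>
  An endomorphism \<open>f\<close> of \<open>xb\<close> can be recovered from \<open>(1 \<boxtimes> f) \<cdot> Rb\<close>. This lies in
  \<open>Hom C (unit_ob C) (x \<otimes> xb)\<close>, which corresponds to \<open>Hom C x x\<close> and is therefore spanned by \<open>Rb\<close>;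
  so \<open>f\<close> is a scalar.
\<close>

lemma conjugate_simple:
  assumes conj: "conjugate_solution C x xb R Rb" and x: "simple C x"
  shows "simple C xb"
proof -
  have R: "R \<in> Hom C (unit_ob C) (xb \<otimes> x)" and Rb: "Rb \<in> Hom C (unit_ob C) (x \<otimes> xb)"
    and eq: "(ident C x \<boxtimes> R\<dagger>) \<cdot> (Rb \<boxtimes> ident C x) = ident C x"
    using conj unfolding conjugate_solution_def by auto
  note i = ident_in_Hom
  have R': "R\<dagger> \<in> Hom C (xb \<otimes> x) (unit_ob C)" using R by (rule adjoint_in_Hom)
  have "ident C xb \<noteq> 0"
  proof
    assume 0: "ident C xb = 0"
    have "Rb = (ident C x \<boxtimes> ident C xb) \<cdot> Rb"
      using ident_compose[OF Rb] by (simp add: tensor_ident)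
    also have "ident C x \<boxtimes> ident C xb = 0"
      unfolding 0 by (rule tensor_zero_right[OF i])
    finally have "Rb = 0" using compose_zero_left[OF Rb] by simp
    then have "Rb \<boxtimes> ident C x = 0"
      using tensor_zero_left[OF i] by simp
    then have "ident C x = 0"
      using eq compose_zero_right[OF tensor_in_Hom[OF i adjoint_in_Hom[OF R], of x]] by simp
    then show False using simple_ident_nonzero[OF x] by simp
  qed
  moreover have "f \<in> range (\<lambda>c. c \<star> ident C xb)" if f: "f \<in> Hom C xb xb" for f
  proof -
    have xf: "ident C x \<boxtimes> f \<in> Hom C (x \<otimes> xb) (x \<otimes> xb)" by (rule tensor_in_Hom[OF i f])
    define T where "T = (ident C x \<boxtimes> f) \<cdot> Rb"
    have T: "T \<in> Hom C (unit_ob C) (x \<otimes> xb)" unfolding T_def using xf Rb by (rule compose_in_Hom)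
    obtain c where c: "(ident C x \<boxtimes> R\<dagger>) \<cdot> (T \<boxtimes> ident C x) = c \<star> ident C x"
      using simple_endomorphism[OF x frobenius_unit(1)[OF conj T]] .
    have "T = ((c \<star> ident C x) \<boxtimes> ident C xb) \<cdot> Rb"
      using frobenius_unit(2)[OF conj T] c by simp
    also have "\<dots> = c \<star> Rb"
      using tensor_scale_left[OF i i, of c x xb] compose_scale_left[OF i Rb] ident_compose[OF Rb]
      by (simp add: tensor_ident)
    finally have Tc: "T = c \<star> Rb" .
    have bRb: "ident C xb \<boxtimes> Rb \<in> Hom C xb (xb \<otimes> x \<otimes> xb)"
      using tensor_in_Hom[OF i Rb, of xb] by (simp add: tensor_ob_unit tensor_ob_assoc)
    have R'b: "R\<dagger> \<boxtimes> ident C xb \<in> Hom C (xb \<otimes> x \<otimes> xb) xb"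
      using tensor_in_Hom[OF R' i, of xb] by (simp add: unit_tensor_ob)
    have bf: "ident C (xb \<otimes> x) \<boxtimes> f \<in> Hom C (xb \<otimes> x \<otimes> xb) (xb \<otimes> x \<otimes> xb)"
      using tensor_in_Hom[OF i f, of "xb \<otimes> x"] by simp
    \<comment> \<open>\<open>f\<close> is slid under the cap \<open>R\<dagger>\<close> until it meets \<open>Rb\<close>\<close>
    have "f = f \<cdot> ((R\<dagger> \<boxtimes> ident C xb) \<cdot> (ident C xb \<boxtimes> Rb))"
      using conjugate_equation_adjoint[OF conj] compose_ident[OF f] by simp
    also have "\<dots> = (f \<cdot> (R\<dagger> \<boxtimes> ident C xb)) \<cdot> (ident C xb \<boxtimes> Rb)"
      by (rule compose_assoc[symmetric, OF f R'b bRb])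
    also have "f \<cdot> (R\<dagger> \<boxtimes> ident C xb) = (R\<dagger> \<boxtimes> ident C xb) \<cdot> (ident C (xb \<otimes> x) \<boxtimes> f)"
      using tensor_left_then[OF R' f] unit_tensor[OF f] by simp
    also have "\<dots> \<cdot> (ident C xb \<boxtimes> Rb) = (R\<dagger> \<boxtimes> ident C xb) \<cdot> ((ident C (xb \<otimes> x) \<boxtimes> f) \<cdot> (ident C xb \<boxtimes> Rb))"
      by (rule compose_assoc[OF R'b bf bRb])
    also have "(ident C (xb \<otimes> x) \<boxtimes> f) \<cdot> (ident C xb \<boxtimes> Rb) = ident C xb \<boxtimes> T"
      using tensor_compose_ident_left[OF xf Rb, of xb] tensor_assoc[OF i i f, of xb x]
      by (simp add: tensor_ident T_def)
    also have "ident C xb \<boxtimes> T = c \<star> (ident C xb \<boxtimes> Rb)"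
      unfolding Tc by (rule tensor_scale_right[OF i Rb])
    also have "(R\<dagger> \<boxtimes> ident C xb) \<cdot> (c \<star> (ident C xb \<boxtimes> Rb)) = c \<star> ident C xb"
      using compose_scale_right[OF R'b bRb] conjugate_equation_adjoint[OF conj] by simp
    finally show ?thesis by blast
  qed
  ultimately show ?thesis unfolding simple_def using scale_in_Hom[OF i] by blast
qed

end

section \<open>Components in the tube algebra\<close>

text \<open>The morphism whose \<open>\<Psi>\<close> is the star of \<open>\<Psi>(w,x,y,g)\<close>: it is \<open>g\<dagger>\<close> turned by a half turn.\<close>

definition rotation ::
  "('o, 'm::ab_group_add, 'z) tube_data_scheme \<Rightarrow> 'o \<Rightarrow> 'o \<Rightarrow> 'o \<Rightarrow> 'm \<Rightarrow> 'm" where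
  "rotation C w x y g =
     ((std_R C w)\<dagger> \<boxtimes> ident C x \<boxtimes> ident C (conj_ob C w)) \<cdot>
     (ident C (conj_ob C w) \<boxtimes> g\<dagger> \<boxtimes> ident C (conj_ob C w)) \<cdot>
     (ident C (conj_ob C w) \<boxtimes> ident C y \<boxtimes> std_Rbar C w)"
  for C (structure)

locale tube_setting = rigid_cstar_tensor_category C
  for C :: "('o, 'm::ab_group_add, 'z) tube_data_scheme" (structure) +
  assumes unit_simple: "simple C (unit_ob C)"
    and representatives: "simple_representatives C"
    and standard: "standard_choice C"
begin

lemma unit_Irr: "unit_ob C \<in> Irr C"
  and Irr_simple: "w \<in> Irr C \<Longrightarrow> simple C w"
  using representatives unfolding simple_representatives_def by auto

lemma Irr_representative: "simple C x \<Longrightarrow> \<exists>v\<in>Irr C. isomorphic C v x"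
  and Irr_representative_unique: "simple C x \<Longrightarrow> v \<in> Irr C \<Longrightarrow> isomorphic C v x \<Longrightarrow>
    v' \<in> Irr C \<Longrightarrow> isomorphic C v' x \<Longrightarrow> v = v'"
  using representatives unfolding simple_representatives_def isomorphic_def by metis+

lemma Irr_Hom_eq_0:
  assumes "v \<in> Irr C" "w \<in> Irr C" "v \<noteq> w" "f \<in> Hom C v w"
  shows "f = 0"
proof (rule ccontr)
  assume "f \<noteq> 0"
  then have "isomorphic C v w"
    using simple_nonzero_isomorphic assms Irr_simple by blast
  moreover have "isomorphic C v v"
    unfolding isomorphic_def using ident_in_Hom[of v] ident_compose[OF ident_in_Hom[of v]] by blast
  ultimately show False
    using representatives assms Irr_simple[OF assms(1)] unfolding simple_representatives_def by blast
qed

lemma std_conjugate: "conjugate_solution C w (conj_ob C w) (std_R C w) (std_Rbar C w)"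
  using standard unfolding standard_choice_def standard_solution_def by blast

lemma std_in_Hom:
  "std_R C w \<in> Hom C (unit_ob C) (conj_ob C w \<otimes> w)"
  "std_Rbar C w \<in> Hom C (unit_ob C) (w \<otimes> conj_ob C w)"
  using std_conjugate[of w] unfolding conjugate_solution_def by auto

lemma onb_simple:
  assumes "simple C v" "simple C y"
  shows "hom_orthonormal_basis C v y (onb C v y)"
  using schur_line[OF assms] orthonormal_basis_of_line[OF assms(1)] by metis

text \<open>
  Here \<open>v\<close> plays the part of the conjugate of \<open>conj_ob C v\<close>: by reciprocity the space corresponds to
  \<open>Hom C (conj_ob C v) y\<close>, a space of morphisms between simple objects.
\<close>

lemma onb_unit:
  assumes v: "simple C v" and y: "simple C y"
  shows "hom_orthonormal_basis C (unit_ob C) (y \<otimes> v) (onb C (unit_ob C) (y \<otimes> v))"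
proof -
  let ?vb = "conj_ob C v" and ?R = "std_R C v"
  note cs = conjugate_solution_sym[OF std_conjugate[of v]]
  obtain f where f: "f \<in> Hom C ?vb y" "Hom C ?vb y = range (\<lambda>c. c \<star> f)"
    using schur_line[OF conjugate_simple[OF std_conjugate v] y] .
  have g: "(f \<boxtimes> ident C v) \<cdot> ?R \<in> Hom C (unit_ob C) (y \<otimes> v)"
    by (rule frobenius_back(1)[OF cs f(1)])
  have "T \<in> range (\<lambda>c. c \<star> ((f \<boxtimes> ident C v) \<cdot> ?R))" if T: "T \<in> Hom C (unit_ob C) (y \<otimes> v)" for T
  proof -
    obtain c where c: "(ident C y \<boxtimes> (std_Rbar C v)\<dagger>) \<cdot> (T \<boxtimes> ident C ?vb) = c \<star> f"
      using frobenius_unit(1)[OF cs T] f(2) by auto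
    have "T = ((c \<star> f) \<boxtimes> ident C v) \<cdot> ?R" using frobenius_unit(2)[OF cs T] c by simp
    also have "\<dots> = c \<star> ((f \<boxtimes> ident C v) \<cdot> ?R)"
      using tensor_scale_left[OF f(1) ident_in_Hom]
        compose_scale_left[OF tensor_in_Hom[OF f(1) ident_in_Hom] std_in_Hom(1)] by simp
    finally show ?thesis by blast
  qed
  then have "Hom C (unit_ob C) (y \<otimes> v) = range (\<lambda>c. c \<star> ((f \<boxtimes> ident C v) \<cdot> ?R))"
    using scale_in_Hom[OF g] by auto
  then show ?thesis using orthonormal_basis_of_line[OF unit_simple g] by simp
qed

text \<open>
  Each basis vector \<open>\<alpha>\<close> contributes \<open>\<alpha>\<dagger> \<cdot> \<alpha> = 1\<close>, so the sum counts the basis of \<open>Hom C v w\<close>, which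
  by Schur's lemma has one element if \<open>v = w\<close> and none otherwise.
\<close>

lemma tube_Psi_unit_component:
  assumes v: "v \<in> Irr C" and w: "w \<in> Irr C"
  shows "tube_Psi C w (unit_ob C) (unit_ob C) (ident C w) (unit_ob C) (unit_ob C) v =
    (if v = w then ident C w else 0)"
proof -
  let ?B = "onb C v w"
  note sv = Irr_simple[OF v]
  have B: "hom_orthonormal_basis C v w ?B" using onb_simple Irr_simple v w by blast
  then have BH: "\<alpha> \<in> Hom C v w" if "\<alpha> \<in> ?B" for \<alpha>
    using that by (auto simp: hom_orthonormal_basis_def)
  have iso: "\<alpha>\<dagger> \<cdot> \<alpha> = ident C v" if "\<alpha> \<in> ?B" for \<alpha>
    using orthonormal_basis_isometry[OF sv B that] .
  have "(ident C (unit_ob C) \<boxtimes> \<alpha>\<dagger>) \<cdot> ident C w \<cdot> (\<alpha> \<boxtimes> ident C (unit_ob C)) = ident C v"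
    if "\<alpha> \<in> ?B" for \<alpha>
    using iso[OF that] unit_tensor[OF adjoint_in_Hom[OF BH[OF that]]] tensor_unit[OF BH[OF that]]
      compose_ident[OF adjoint_in_Hom[OF BH[OF that]]] by simp
  then have eq: "tube_Psi C w (unit_ob C) (unit_ob C) (ident C w) (unit_ob C) (unit_ob C) v
      = (\<Sum>\<alpha>\<in>?B. ident C v)"
    using v by (simp add: tube_Psi_def flip: onb_def)
  show ?thesis
  proof (cases "v = w")
    case False
    have "?B = {}"
      using Irr_Hom_eq_0[OF v w False BH] iso simple_ident_nonzero[OF sv]
        compose_zero_right[OF adjoint_in_Hom] adjoint_zero zero_in_Hom by (metis equals0I)
    then show ?thesis using eq False by simp
  next
    case True
    \<comment> \<open>distinct elements of an orthonormal basis are orthogonal multiples of the identity\<close>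
    have "\<alpha> = \<beta>" if ab: "\<alpha> \<in> ?B" "\<beta> \<in> ?B" for \<alpha> \<beta>
    proof (rule ccontr)
      assume ne: "\<alpha> \<noteq> \<beta>"
      obtain c where c: "\<alpha> = c \<star> ident C v"
        using simple_endomorphism[OF sv] BH[OF ab(1)] True by metis
      obtain d where d: "\<beta>\<dagger> = d \<star> ident C v"
        using simple_endomorphism[OF sv] adjoint_in_Hom[OF BH[OF ab(2)]] True by metis
      have i: "ident C v \<in> Hom C v v" by (rule ident_in_Hom)
      have "\<beta>\<dagger> \<cdot> \<alpha> = (d * c) \<star> ident C v"
        unfolding c d by (simp add: compose_scale_left[OF i scale_in_Hom[OF i]]
            compose_scale_right[OF i i] ident_compose[OF i])
      then have "d * c = 0"
        using hom_inner_eqI[OF sv] B ab ne unfolding hom_orthonormal_basis_def by metis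
      moreover have "c \<noteq> 0" "d \<noteq> 0"
        using iso[OF ab(1)] iso[OF ab(2)] c d simple_ident_nonzero[OF sv]
          compose_zero_right[OF adjoint_in_Hom[OF BH[OF ab(1)]]]
          compose_zero_left[OF BH[OF ab(2)]] by auto
      ultimately show False by simp
    qed
    moreover have "?B \<noteq> {}"
    proof
      assume "?B = {}"
      then have "Hom C v w = {0}" using B by (simp add: hom_orthonormal_basis_def)
      then show False using ident_in_Hom[of v] True simple_ident_nonzero[OF sv] by auto
    qed
    ultimately obtain \<alpha> where "?B = {\<alpha>}" by blast
    then show ?thesis using eq True by simp
  qed
qed

text \<open>Hence the coefficients of \<open>f\<close>, in particular the one at the unit, can be read off in the tube algebra.\<close>

lemma fusion_embed_component:
  assumes f: "f \<in> fusion_algebra C" and v: "v \<in> Irr C"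
  shows "fusion_embed C f (unit_ob C) (unit_ob C) v = f v \<star> ident C v"
proof -
  have fin: "finite {w. f w \<noteq> 0}" and sub: "{w. f w \<noteq> 0} \<subseteq> Irr C"
    using f by (auto simp: fusion_algebra_def)
  have "fusion_embed C f (unit_ob C) (unit_ob C) v
      = (\<Sum>w | f w \<noteq> 0. f w \<star> tube_Psi C w (unit_ob C) (unit_ob C) (ident C w) (unit_ob C) (unit_ob C) v)"
    unfolding fusion_embed_def by (simp add: sum_fun_apply)
  also have "\<dots> = (\<Sum>w | f w \<noteq> 0. if w = v then f v \<star> ident C v else 0)"
    using sub tube_Psi_unit_component[OF v] by (intro sum.cong) auto
  also have "\<dots> = f v \<star> ident C v" using fin by (simp add: sum.delta)
  finally show ?thesis .
qed

lemma rotation_in_Hom: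
  assumes g: "g \<in> Hom C (w \<otimes> x) (y \<otimes> w)"
  shows "rotation C w x y g \<in> Hom C (conj_ob C w \<otimes> y) (x \<otimes> conj_ob C w)"
proof -
  let ?wb = "conj_ob C w"
  note i = ident_in_Hom
  have "(std_R C w)\<dagger> \<boxtimes> ident C x \<boxtimes> ident C ?wb \<in> Hom C (?wb \<otimes> w \<otimes> x \<otimes> ?wb) (x \<otimes> ?wb)"
    using tensor_in_Hom[OF tensor_in_Hom[OF adjoint_in_Hom[OF std_in_Hom(1)[of w]] i[of x]] i[of ?wb]]
    by (simp add: unit_tensor_ob)
  moreover have "ident C ?wb \<boxtimes> g\<dagger> \<boxtimes> ident C ?wb \<in> Hom C (?wb \<otimes> y \<otimes> w \<otimes> ?wb) (?wb \<otimes> w \<otimes> x \<otimes> ?wb)"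
    using tensor_in_Hom[OF tensor_in_Hom[OF i[of ?wb] adjoint_in_Hom[OF g]] i[of ?wb]]
    by (simp add: tensor_ob_assoc)
  moreover have "ident C ?wb \<boxtimes> ident C y \<boxtimes> std_Rbar C w \<in> Hom C (?wb \<otimes> y) (?wb \<otimes> y \<otimes> w \<otimes> ?wb)"
    using tensor_in_Hom[OF tensor_in_Hom[OF i[of ?wb] i[of y]] std_in_Hom(2)[of w]]
    by (simp add: tensor_ob_unit tensor_ob_assoc)
  ultimately show ?thesis unfolding rotation_def by (metis compose_in_Hom)
qed

text \<open>
  The cup \<open>std_Rbar C w\<close> and the cap \<open>(std_R C w)\<dagger>\<close> inside the rotation form a zigzag with the
  composed cup, and the conjugate equation pulls it straight. Turning \<open>g\<dagger>\<close> around on the right leg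
  of the cup thus amounts to applying \<open>g\<dagger>\<close> itself on the left leg.
\<close>

lemma rotation_Rbar:
  assumes g: "g \<in> Hom C (w \<otimes> x) w"
  shows "(ident C w \<boxtimes> rotation C w x (unit_ob C) g) \<cdot> std_Rbar C w
    = (g\<dagger> \<boxtimes> ident C (conj_ob C w)) \<cdot> std_Rbar C w"
proof -
  let ?wb = "conj_ob C w" and ?R = "std_R C w" and ?Rb = "std_Rbar C w"
  let ?I = "ident C"
  note i = ident_in_Hom
  note R = std_in_Hom(1)[of w] and Rb = std_in_Hom(2)[of w]
  note R' = adjoint_in_Hom[OF R] and g' = adjoint_in_Hom[OF g]
  let ?A = "?R\<dagger> \<boxtimes> ?I x \<boxtimes> ?I ?wb" and ?B = "?I ?wb \<boxtimes> g\<dagger> \<boxtimes> ?I ?wb" and ?D = "?I ?wb \<boxtimes> ?Rb"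
  have A: "?A \<in> Hom C (?wb \<otimes> w \<otimes> x \<otimes> ?wb) (x \<otimes> ?wb)"
    using tensor_in_Hom[OF tensor_in_Hom[OF R' i[of x]] i[of ?wb]]
    by (simp add: unit_tensor_ob)
  have B: "?B \<in> Hom C (?wb \<otimes> w \<otimes> ?wb) (?wb \<otimes> w \<otimes> x \<otimes> ?wb)"
    using tensor_in_Hom[OF tensor_in_Hom[OF i[of ?wb] g'] i[of ?wb]]
    by (simp add: tensor_ob_assoc)
  have D: "?D \<in> Hom C ?wb (?wb \<otimes> w \<otimes> ?wb)"
    using tensor_in_Hom[OF i[of ?wb] Rb] by (simp add: tensor_ob_unit tensor_ob_assoc)
  have wA: "?I w \<boxtimes> ?A \<in> Hom C (w \<otimes> ?wb \<otimes> w \<otimes> x \<otimes> ?wb) (w \<otimes> x \<otimes> ?wb)"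
    using tensor_in_Hom[OF i[of w] A] by (simp add: tensor_ob_assoc)
  have wB: "?I w \<boxtimes> ?B \<in> Hom C (w \<otimes> ?wb \<otimes> w \<otimes> ?wb) (w \<otimes> ?wb \<otimes> w \<otimes> x \<otimes> ?wb)"
    using tensor_in_Hom[OF i[of w] B] by (simp add: tensor_ob_assoc)
  have wD: "?I w \<boxtimes> ?D \<in> Hom C (w \<otimes> ?wb) (w \<otimes> ?wb \<otimes> w \<otimes> ?wb)"
    using tensor_in_Hom[OF i[of w] D] by (simp add: tensor_ob_assoc)
  have gw: "g\<dagger> \<boxtimes> ?I ?wb \<in> Hom C (w \<otimes> ?wb) (w \<otimes> x \<otimes> ?wb)"
    using tensor_in_Hom[OF g' i[of ?wb]] by simp
  have Rbw: "?Rb \<boxtimes> ?I (w \<otimes> ?wb) \<in> Hom C (w \<otimes> ?wb) (w \<otimes> ?wb \<otimes> w \<otimes> ?wb)"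
    using tensor_in_Hom[OF Rb i[of "w \<otimes> ?wb"]] by (simp add: unit_tensor_ob tensor_ob_assoc)
  have Rbx: "?Rb \<boxtimes> ?I (w \<otimes> x \<otimes> ?wb) \<in> Hom C (w \<otimes> x \<otimes> ?wb) (w \<otimes> ?wb \<otimes> w \<otimes> x \<otimes> ?wb)"
    using tensor_in_Hom[OF Rb i[of "w \<otimes> x \<otimes> ?wb"]] by (simp add: unit_tensor_ob tensor_ob_assoc)
  have "?I w \<boxtimes> rotation C w x (unit_ob C) g = (?I w \<boxtimes> ?A) \<cdot> (?I w \<boxtimes> ?B) \<cdot> (?I w \<boxtimes> ?D)"
    using tensor_compose_ident_left[OF A B, of w]
      tensor_compose_ident_left[OF compose_in_Hom[OF A B] D, of w]
    by (simp add: rotation_def tensor_unit[OF i[of ?wb]])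
  then have "(?I w \<boxtimes> rotation C w x (unit_ob C) g) \<cdot> ?Rb
      = (?I w \<boxtimes> ?A) \<cdot> ((?I w \<boxtimes> ?B) \<cdot> ((?I w \<boxtimes> ?D) \<cdot> ?Rb))"
    using compose_assoc[OF compose_in_Hom[OF wA wB] wD Rb]
      compose_assoc[OF wA wB compose_in_Hom[OF wD Rb]] by simp
  also have "(?I w \<boxtimes> ?D) \<cdot> ?Rb = (?Rb \<boxtimes> ?I (w \<otimes> ?wb)) \<cdot> ?Rb"
    using tensor_left_then[OF Rb Rb] tensor_unit[OF Rb] unit_tensor[OF Rb]
      tensor_assoc[OF i i Rb, of w ?wb] by (simp add: tensor_ident)
  also have "(?I w \<boxtimes> ?B) \<cdot> ((?Rb \<boxtimes> ?I (w \<otimes> ?wb)) \<cdot> ?Rb)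
      = ((?I w \<boxtimes> ?B) \<cdot> (?Rb \<boxtimes> ?I (w \<otimes> ?wb))) \<cdot> ?Rb"
    by (rule compose_assoc[symmetric, OF wB Rbw Rb])
  also have "(?I w \<boxtimes> ?B) \<cdot> (?Rb \<boxtimes> ?I (w \<otimes> ?wb))
      = (?Rb \<boxtimes> ?I (w \<otimes> x \<otimes> ?wb)) \<cdot> (g\<dagger> \<boxtimes> ?I ?wb)"
    using tensor_left_then[OF Rb gw] unit_tensor[OF gw]
      tensor_assoc[OF i g' i, of ?wb ?wb] tensor_assoc[OF i i gw, of w ?wb]
    by (simp add: tensor_ident)
  also have "((?Rb \<boxtimes> ?I (w \<otimes> x \<otimes> ?wb)) \<cdot> (g\<dagger> \<boxtimes> ?I ?wb)) \<cdot> ?Rb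
      = (?Rb \<boxtimes> ?I (w \<otimes> x \<otimes> ?wb)) \<cdot> ((g\<dagger> \<boxtimes> ?I ?wb) \<cdot> ?Rb)"
    by (rule compose_assoc[OF Rbx gw Rb])
  also have "(?I w \<boxtimes> ?A) \<cdot> ((?Rb \<boxtimes> ?I (w \<otimes> x \<otimes> ?wb)) \<cdot> ((g\<dagger> \<boxtimes> ?I ?wb) \<cdot> ?Rb))
      = ((?I w \<boxtimes> ?A) \<cdot> (?Rb \<boxtimes> ?I (w \<otimes> x \<otimes> ?wb))) \<cdot> ((g\<dagger> \<boxtimes> ?I ?wb) \<cdot> ?Rb)"
    by (rule compose_assoc[symmetric, OF wA Rbx compose_in_Hom[OF gw Rb]])
  also have "(?I w \<boxtimes> ?A) \<cdot> (?Rb \<boxtimes> ?I (w \<otimes> x \<otimes> ?wb)) = ?I (w \<otimes> x \<otimes> ?wb)"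
  proof -
    have wR': "?I w \<boxtimes> ?R\<dagger> \<in> Hom C (w \<otimes> ?wb \<otimes> w) w"
      using tensor_in_Hom[OF i[of w] R'] by (simp add: tensor_ob_unit tensor_ob_assoc)
    have Rbw': "?Rb \<boxtimes> ?I w \<in> Hom C w (w \<otimes> ?wb \<otimes> w)"
      using tensor_in_Hom[OF Rb i[of w]] by (simp add: unit_tensor_ob)
    have "?I w \<boxtimes> ?A = (?I w \<boxtimes> ?R\<dagger>) \<boxtimes> ?I (x \<otimes> ?wb)"
      using tensor_assoc[OF R' i i, of x ?wb] tensor_assoc[OF i R' i, of w "x \<otimes> ?wb"]
      by (simp add: tensor_ident)
    moreover have "?Rb \<boxtimes> ?I (w \<otimes> x \<otimes> ?wb) = (?Rb \<boxtimes> ?I w) \<boxtimes> ?I (x \<otimes> ?wb)"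
      using tensor_assoc[OF Rb i i, of w "x \<otimes> ?wb"] by (simp add: tensor_ident tensor_ob_assoc)
    moreover have "(?I w \<boxtimes> ?R\<dagger>) \<cdot> (?Rb \<boxtimes> ?I w) = ?I w"
      using std_conjugate[of w] by (simp add: conjugate_solution_def)
    ultimately show ?thesis
      using tensor_compose_ident_right[OF wR' Rbw', of "x \<otimes> ?wb"]
      by (simp add: tensor_ident tensor_ob_assoc)
  qed
  also have "\<dots> \<cdot> ((g\<dagger> \<boxtimes> ?I ?wb) \<cdot> ?Rb) = (g\<dagger> \<boxtimes> ?I ?wb) \<cdot> ?Rb"
    by (rule ident_compose[OF compose_in_Hom[OF gw Rb]])
  finally show ?thesis .
qed


lemma tube_space_components:
  assumes a: "a \<in> tube_space C x (unit_ob C)" and x: "x \<in> Irr C"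
  defines "W \<equiv> {w. a x (unit_ob C) w \<noteq> 0}"
  shows "finite W" "W \<subseteq> Irr C" "tube_support a = (\<lambda>w. (x, unit_ob C, w)) ` W"
    "w \<in> Irr C \<Longrightarrow> a x (unit_ob C) w \<in> Hom C (w \<otimes> x) w"
proof -
  have fin: "finite (tube_support a)" and sub: "tube_support a \<subseteq> Irr C \<times> Irr C \<times> Irr C"
    and hom: "\<forall>x\<in>Irr C. \<forall>y\<in>Irr C. \<forall>w\<in>Irr C. a x y w \<in> Hom C (w \<otimes> x) (y \<otimes> w)"
    and sup: "tube_support a \<subseteq> {x} \<times> {unit_ob C} \<times> UNIV"
    using a unfolding tube_space_def tube_algebra_def by auto
  show supp: "tube_support a = (\<lambda>w. (x, unit_ob C, w)) ` W"
    using sup unfolding W_def tube_support_def by auto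
  show "finite W"
    using fin unfolding supp by (rule finite_imageD) (auto simp: inj_on_def)
  show "W \<subseteq> Irr C" using sub unfolding supp by auto
  show "w \<in> Irr C \<Longrightarrow> a x (unit_ob C) w \<in> Hom C (w \<otimes> x) w"
    using hom x unit_Irr by (metis unit_tensor_ob)
qed

text \<open>
  For \<open>a\<close> in a single space \<open>tube_space C x (unit_ob C)\<close>, the sums over triples in the definitions of the
  star and the product reduce to sums over the simple objects \<open>w\<close>.
\<close>

lemma tube_star_component:
  assumes a: "a \<in> tube_space C x (unit_ob C)" and x: "x \<in> Irr C"
  shows "tube_star C a x' y' v =
    (if x' = unit_ob C \<and> y' = x \<and> v \<in> Irr C
     then \<Sum>w | a x (unit_ob C) w \<noteq> 0. \<Sum>\<alpha>\<in>onb C v (conj_ob C w).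
       (ident C x \<boxtimes> \<alpha>\<dagger>) \<cdot> rotation C w x (unit_ob C) (a x (unit_ob C) w) \<cdot> (\<alpha> \<boxtimes> ident C (unit_ob C))
     else 0)"
proof -
  let ?W = "{w. a x (unit_ob C) w \<noteq> 0}"
  have "tube_star C a = (\<Sum>(x, y, w)\<in>tube_support a.
      tube_Psi C (conj_ob C w) y x (rotation C w x y (a x y w)))"
    unfolding tube_star_def rotation_def ..
  also have "\<dots> = (\<Sum>w\<in>?W. tube_Psi C (conj_ob C w) (unit_ob C) x
      (rotation C w x (unit_ob C) (a x (unit_ob C) w)))"
    unfolding tube_space_components(3)[OF a x]
    by (subst sum.reindex) (auto simp: inj_on_def)
  finally show ?thesis
    by (auto simp: sum_fun_apply tube_Psi_def simp flip: onb_def intro!: sum.neutral)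
qed

lemma tube_mult_unit_component:
  assumes a: "a \<in> tube_space C x (unit_ob C)" and x: "x \<in> Irr C"
  defines "W \<equiv> {w. a x (unit_ob C) w \<noteq> 0}" and "b \<equiv> tube_star C a (unit_ob C) x"
  shows "tube_mult C a (tube_star C a) (unit_ob C) (unit_ob C) (unit_ob C) =
    (\<Sum>w\<in>W. \<Sum>v | b v \<noteq> 0. \<Sum>T\<in>onb C (unit_ob C) (w \<otimes> v).
      (ident C (unit_ob C) \<boxtimes> T\<dagger>) \<cdot> ((a x (unit_ob C) w \<boxtimes> ident C v) \<cdot> (ident C w \<boxtimes> b v)) \<cdot>
        (T \<boxtimes> ident C (unit_ob C)))"
proof -
  have sb: "tube_support (tube_star C a) = (\<lambda>v. (unit_ob C, x, v)) ` {v. b v \<noteq> 0}"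
    unfolding tube_support_def b_def using tube_star_component[OF a x] by (auto split: if_splits)
  have "tube_mult C a (tube_star C a) = (\<Sum>w\<in>W. \<Sum>v | b v \<noteq> 0.
      tube_Psi C (w \<otimes> v) (unit_ob C) (unit_ob C)
        ((a x (unit_ob C) w \<boxtimes> ident C v) \<cdot> (ident C w \<boxtimes> b v)))"
    unfolding tube_mult_def tube_space_components(3)[OF a x] sb W_def
    by (simp add: sum.reindex inj_on_def b_def)
  then show ?thesis
    using unit_Irr by (simp add: sum_fun_apply tube_Psi_def flip: onb_def)
qed

section \<open>The unit component of a square\<close>

text \<open>
  With \<open>S = (1 \<boxtimes> \<alpha>) \<cdot> T\<close> this is the morphism \<open>(k\<dagger> \<boxtimes> 1) \<cdot> S\<close> whose squares make up the unit
  component of \<open>a a*\<close>, where \<open>k\<close> is the component of \<open>a\<close> at \<open>w\<close>.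
\<close>

definition gram_vector :: "'o \<Rightarrow> 'm \<Rightarrow> 'm \<Rightarrow> 'm \<Rightarrow> 'm" where
  "gram_vector w k \<alpha> T = (k\<dagger> \<boxtimes> ident C (conj_ob C w)) \<cdot> ((ident C w \<boxtimes> \<alpha>) \<cdot> T)"

text \<open>By reciprocity, \<open>Hom C (unit_ob C) (u \<otimes> conj_ob C w)\<close> corresponds to \<open>Hom C w u\<close>.\<close>

lemma Hom_unit_conj:
  assumes w: "w \<in> Irr C" and u: "u \<in> Irr C" and S: "S \<in> Hom C (unit_ob C) (u \<otimes> conj_ob C w)"
  shows "u \<noteq> w \<Longrightarrow> S = 0" and "u = w \<Longrightarrow> \<exists>c. S = c \<star> std_Rbar C w"
proof -
  note i = ident_in_Hom
  note F = frobenius_unit[OF std_conjugate S]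
  show "S = 0" if "u \<noteq> w"
  proof -
    have "(ident C u \<boxtimes> (std_R C w)\<dagger>) \<cdot> (S \<boxtimes> ident C w) = 0"
      using Irr_Hom_eq_0[OF w u _ F(1)] that by simp
    then show ?thesis
      using F(2) compose_zero_left[OF std_in_Hom(2)] tensor_zero_left[OF i] by metis
  qed
  show "\<exists>c. S = c \<star> std_Rbar C w" if "u = w"
  proof -
    have "(ident C u \<boxtimes> (std_R C w)\<dagger>) \<cdot> (S \<boxtimes> ident C w) \<in> Hom C w w" using F(1) that by simp
    then obtain c where c: "(ident C u \<boxtimes> (std_R C w)\<dagger>) \<cdot> (S \<boxtimes> ident C w) = c \<star> ident C w"
      by (rule simple_endomorphism[OF Irr_simple[OF w]])
    have "S = ((c \<star> ident C w) \<boxtimes> ident C (conj_ob C w)) \<cdot> std_Rbar C w"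
      using F(2) c by simp
    also have "\<dots> = c \<star> std_Rbar C w"
      using tensor_scale_left[OF i i, of c w "conj_ob C w"] compose_scale_left[OF i std_in_Hom(2)]
        ident_compose[OF std_in_Hom(2)] by (simp add: tensor_ident)
    finally show ?thesis ..
  qed
qed

lemma gram_vector_in_Hom:
  assumes "k \<in> Hom C (w \<otimes> x) w" "\<alpha> \<in> Hom C v (conj_ob C w)" "T \<in> Hom C (unit_ob C) (w \<otimes> v)"
  shows "gram_vector w k \<alpha> T \<in> Hom C (unit_ob C) (w \<otimes> x \<otimes> conj_ob C w)"
  unfolding gram_vector_def
  by (intro compose_in_Hom[OF tensor_in_Hom[OF adjoint_in_Hom[OF assms(1)] ident_in_Hom]]
      compose_in_Hom[OF tensor_in_Hom[OF ident_in_Hom assms(2)] assms(3)])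

text \<open>
  Since \<open>\<alpha>\<dagger>\<close> slides past \<open>g u\<close>, the left side is \<open>S\<dagger> \<cdot> (g u \<boxtimes> 1) \<cdot> (1 \<boxtimes> rotation) \<cdot> S\<close> with
  \<open>S = (1 \<boxtimes> \<alpha>) \<cdot> T\<close>. For \<open>u \<noteq> w\<close> there is no nonzero \<open>S\<close>. For \<open>u = w\<close> it is a multiple of
  \<open>std_Rbar C w\<close>, which turns the rotated morphism into \<open>(g w)\<dagger>\<close> on the other side.
\<close>

lemma square_term:
  assumes u: "u \<in> Irr C" and w: "w \<in> Irr C"
    and g: "\<And>w. w \<in> Irr C \<Longrightarrow> g w \<in> Hom C (w \<otimes> x) w"
    and \<alpha>: "\<alpha> \<in> Hom C v (conj_ob C w)" and T: "T \<in> Hom C (unit_ob C) (u \<otimes> v)"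
  shows "T\<dagger> \<cdot> ((g u \<boxtimes> ident C v) \<cdot> (ident C u \<boxtimes> ((ident C x \<boxtimes> \<alpha>\<dagger>) \<cdot> rotation C w x (unit_ob C) (g w) \<cdot> \<alpha>))) \<cdot> T
    = (if u = w then (gram_vector w (g w) \<alpha> T)\<dagger> \<cdot> gram_vector w (g w) \<alpha> T else 0)"
proof -
  let ?I = "ident C" and ?wb = "conj_ob C w" and ?\<rho> = "rotation C w x (unit_ob C) (g w)"
  note i = ident_in_Hom
  define S where "S = (?I u \<boxtimes> \<alpha>) \<cdot> T"
  note \<alpha>' = adjoint_in_Hom[OF \<alpha>] and T' = adjoint_in_Hom[OF T]
  have u\<alpha>: "?I u \<boxtimes> \<alpha> \<in> Hom C (u \<otimes> v) (u \<otimes> ?wb)" by (rule tensor_in_Hom[OF i \<alpha>])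
  have S: "S \<in> Hom C (unit_ob C) (u \<otimes> ?wb)" unfolding S_def by (rule compose_in_Hom[OF u\<alpha> T])
  note S' = adjoint_in_Hom[OF S]
  have \<rho>: "?\<rho> \<in> Hom C ?wb (x \<otimes> ?wb)"
    using rotation_in_Hom[of "g w" w x "unit_ob C"] g[OF w] by (simp add: unit_tensor_ob tensor_ob_unit)
  have x\<alpha>: "?I x \<boxtimes> \<alpha>\<dagger> \<in> Hom C (x \<otimes> ?wb) (x \<otimes> v)" by (rule tensor_in_Hom[OF i \<alpha>'])
  have ux\<alpha>: "?I u \<boxtimes> (?I x \<boxtimes> \<alpha>\<dagger>) \<in> Hom C (u \<otimes> x \<otimes> ?wb) (u \<otimes> x \<otimes> v)"
    using tensor_in_Hom[OF i[of u] x\<alpha>] by (simp add: tensor_ob_assoc)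
  have u\<rho>: "?I u \<boxtimes> ?\<rho> \<in> Hom C (u \<otimes> ?wb) (u \<otimes> x \<otimes> ?wb)"
    using tensor_in_Hom[OF i[of u] \<rho>] by (simp add: tensor_ob_assoc)
  have gv: "g u \<boxtimes> ?I v \<in> Hom C (u \<otimes> x \<otimes> v) (u \<otimes> v)" by (rule tensor_in_Hom[OF g[OF u] i])
  have gwb: "g u \<boxtimes> ?I ?wb \<in> Hom C (u \<otimes> x \<otimes> ?wb) (u \<otimes> ?wb)" by (rule tensor_in_Hom[OF g[OF u] i])
  have u\<alpha>': "?I u \<boxtimes> \<alpha>\<dagger> \<in> Hom C (u \<otimes> ?wb) (u \<otimes> v)" by (rule tensor_in_Hom[OF i \<alpha>'])
  have S'_eq: "S\<dagger> = T\<dagger> \<cdot> (?I u \<boxtimes> \<alpha>\<dagger>)"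
    unfolding S_def using adjoint_compose[OF u\<alpha> T] adjoint_tensor[OF i \<alpha>] by (simp add: adjoint_ident)
  have slide: "(g u \<boxtimes> ?I v) \<cdot> (?I u \<boxtimes> (?I x \<boxtimes> \<alpha>\<dagger>)) = (?I u \<boxtimes> \<alpha>\<dagger>) \<cdot> (g u \<boxtimes> ?I ?wb)"
    using tensor_left_then[OF g[OF u] \<alpha>'] tensor_assoc[OF i i \<alpha>', of u x] by (simp add: tensor_ident)
  have "(g u \<boxtimes> ?I v) \<cdot> (?I u \<boxtimes> ((?I x \<boxtimes> \<alpha>\<dagger>) \<cdot> ?\<rho> \<cdot> \<alpha>))
      = (g u \<boxtimes> ?I v) \<cdot> ((?I u \<boxtimes> (?I x \<boxtimes> \<alpha>\<dagger>)) \<cdot> ((?I u \<boxtimes> ?\<rho>) \<cdot> (?I u \<boxtimes> \<alpha>)))"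
    using tensor_compose_ident_left[OF compose_in_Hom[OF x\<alpha> \<rho>] \<alpha>, of u]
      tensor_compose_ident_left[OF x\<alpha> \<rho>, of u] compose_assoc[OF ux\<alpha> u\<rho> u\<alpha>] by simp
  also have "\<dots> = ((?I u \<boxtimes> \<alpha>\<dagger>) \<cdot> (g u \<boxtimes> ?I ?wb)) \<cdot> ((?I u \<boxtimes> ?\<rho>) \<cdot> (?I u \<boxtimes> \<alpha>))"
    using compose_assoc[OF gv ux\<alpha> compose_in_Hom[OF u\<rho> u\<alpha>]] slide by simp
  also have "\<dots> = (?I u \<boxtimes> \<alpha>\<dagger>) \<cdot> ((g u \<boxtimes> ?I ?wb) \<cdot> ((?I u \<boxtimes> ?\<rho>) \<cdot> (?I u \<boxtimes> \<alpha>)))"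
    by (rule compose_assoc[OF u\<alpha>' gwb compose_in_Hom[OF u\<rho> u\<alpha>]])
  finally have "T\<dagger> \<cdot> ((g u \<boxtimes> ?I v) \<cdot> (?I u \<boxtimes> ((?I x \<boxtimes> \<alpha>\<dagger>) \<cdot> ?\<rho> \<cdot> \<alpha>))) \<cdot> T
      = T\<dagger> \<cdot> ((?I u \<boxtimes> \<alpha>\<dagger>) \<cdot> ((g u \<boxtimes> ?I ?wb) \<cdot> ((?I u \<boxtimes> ?\<rho>) \<cdot> (?I u \<boxtimes> \<alpha>)))) \<cdot> T"
    by simp
  also have "\<dots> = S\<dagger> \<cdot> ((g u \<boxtimes> ?I ?wb) \<cdot> ((?I u \<boxtimes> ?\<rho>) \<cdot> (?I u \<boxtimes> \<alpha>))) \<cdot> T"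
    unfolding S'_eq
    using compose_assoc[OF T' u\<alpha>' compose_in_Hom[OF gwb compose_in_Hom[OF u\<rho> u\<alpha>]]] by simp
  also have "\<dots> = S\<dagger> \<cdot> (((g u \<boxtimes> ?I ?wb) \<cdot> ((?I u \<boxtimes> ?\<rho>) \<cdot> (?I u \<boxtimes> \<alpha>))) \<cdot> T)"
    by (rule compose_assoc[OF S' compose_in_Hom[OF gwb compose_in_Hom[OF u\<rho> u\<alpha>]] T])
  also have "((g u \<boxtimes> ?I ?wb) \<cdot> ((?I u \<boxtimes> ?\<rho>) \<cdot> (?I u \<boxtimes> \<alpha>))) \<cdot> T = (g u \<boxtimes> ?I ?wb) \<cdot> ((?I u \<boxtimes> ?\<rho>) \<cdot> S)"
    unfolding S_def
    using compose_assoc[OF gwb compose_in_Hom[OF u\<rho> u\<alpha>] T] compose_assoc[OF u\<rho> u\<alpha> T] by simp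
  finally have eq: "T\<dagger> \<cdot> ((g u \<boxtimes> ?I v) \<cdot> (?I u \<boxtimes> ((?I x \<boxtimes> \<alpha>\<dagger>) \<cdot> ?\<rho> \<cdot> \<alpha>))) \<cdot> T
      = S\<dagger> \<cdot> ((g u \<boxtimes> ?I ?wb) \<cdot> ((?I u \<boxtimes> ?\<rho>) \<cdot> S))" .
  show ?thesis
  proof (cases "u = w")
    case False
    then have "S = 0" using Hom_unit_conj(1)[OF w u S] by simp
    then show ?thesis
      using eq False compose_zero_right[OF u\<rho>] compose_zero_right[OF gwb] compose_zero_right[OF S']
      by simp
  next
    case True
    have gw: "(g w)\<dagger> \<boxtimes> ?I ?wb \<in> Hom C (w \<otimes> ?wb) (w \<otimes> x \<otimes> ?wb)"
      using tensor_in_Hom[OF adjoint_in_Hom[OF g[OF w]] i[of ?wb]] by simp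
    obtain c where c: "S = c \<star> std_Rbar C w" using Hom_unit_conj(2)[OF w u S True] by blast
    have \<rho>S: "(?I u \<boxtimes> ?\<rho>) \<cdot> S = ((g w)\<dagger> \<boxtimes> ?I ?wb) \<cdot> S"
      unfolding c using True rotation_Rbar[OF g[OF w]] compose_scale_right[OF u\<rho> , of "std_Rbar C w" "unit_ob C"]
        compose_scale_right[OF gw std_in_Hom(2)] std_in_Hom(2)[of w] by simp
    have "S\<dagger> \<cdot> ((g u \<boxtimes> ?I ?wb) \<cdot> (((g w)\<dagger> \<boxtimes> ?I ?wb) \<cdot> S))
       = (((g w)\<dagger> \<boxtimes> ?I ?wb) \<cdot> S)\<dagger> \<cdot> (((g w)\<dagger> \<boxtimes> ?I ?wb) \<cdot> S)"
      using adjoint_compose[OF gw S[unfolded True]] adjoint_tensor[OF adjoint_in_Hom[OF g[OF w]] i[of ?wb]]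
        adjoint_adjoint[OF g[OF w]] True
        compose_assoc[OF S'[unfolded True] gwb[unfolded True] compose_in_Hom[OF gw S[unfolded True]]]
      by (simp add: adjoint_ident)
    then show ?thesis using eq \<rho>S True by (simp add: gram_vector_def S_def)
  qed
qed

text \<open>
  The object \<open>v\<close> is the representative of \<open>conj_ob C w\<close>. Then \<open>\<alpha>\<close> is unitary, so \<open>(1 \<boxtimes> \<alpha>) \<cdot> T\<close> is a
  nonzero multiple of \<open>std_Rbar C w\<close>, and bending \<open>(k\<dagger> \<boxtimes> 1) \<cdot> std_Rbar C w\<close> back yields \<open>k\<dagger>\<close>.
\<close>

lemma gram_vector_nonzero:
  assumes w: "w \<in> Irr C" and k: "k \<in> Hom C (w \<otimes> x) w" "k \<noteq> 0"
  obtains v \<alpha> T where "v \<in> Irr C" "\<alpha> \<in> onb C v (conj_ob C w)" "T \<in> onb C (unit_ob C) (w \<otimes> v)"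
    "gram_vector w k \<alpha> T \<noteq> 0"
proof -
  let ?I = "ident C" and ?wb = "conj_ob C w" and ?Rb = "std_Rbar C w"
  note i = ident_in_Hom and Rb = std_in_Hom(2)[of w]
  have swb: "simple C ?wb" using conjugate_simple[OF std_conjugate Irr_simple[OF w]] .
  obtain v f f' where v: "v \<in> Irr C" and f: "f \<in> Hom C v ?wb" "f' \<in> Hom C ?wb v" "f' \<cdot> f = ?I v"
    using Irr_representative[OF swb] unfolding isomorphic_def by blast
  have sv: "simple C v" using Irr_simple[OF v] .
  have B: "hom_orthonormal_basis C v ?wb (onb C v ?wb)" by (rule onb_simple[OF sv swb])
  have "f \<noteq> 0" using f simple_ident_nonzero[OF sv] compose_zero_right[OF f(2)] by auto
  then have "onb C v ?wb \<noteq> {}"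
    using B f(1) unfolding hom_orthonormal_basis_def by (metis empty_iff insert_iff span_empty)
  then obtain \<alpha> where \<alpha>B: "\<alpha> \<in> onb C v ?wb" by blast
  have \<alpha>: "\<alpha> \<in> Hom C v ?wb" using B \<alpha>B by (auto simp: hom_orthonormal_basis_def)
  note \<alpha>' = adjoint_in_Hom[OF \<alpha>]
  have \<alpha>1: "\<alpha>\<dagger> \<cdot> \<alpha> = ?I v" by (rule orthonormal_basis_isometry[OF sv B \<alpha>B])
  have "\<alpha> \<noteq> 0" using \<alpha>1 simple_ident_nonzero[OF sv] compose_zero_right[OF \<alpha>'] by auto
  then obtain r where r: "\<alpha>\<dagger> \<cdot> \<alpha> = complex_of_real r \<star> ?I v" "\<alpha> \<cdot> \<alpha>\<dagger> = complex_of_real r \<star> ?I ?wb"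
    using schur[OF sv swb \<alpha>] by metis
  have "complex_of_real r = 1"
    using r(1) \<alpha>1 simple_ident_nonzero[OF sv] by (metis scale_one scale_right_imp_eq)
  then have \<alpha>2: "\<alpha> \<cdot> \<alpha>\<dagger> = ?I ?wb" using r(2) by simp
  have w\<alpha>: "?I w \<boxtimes> \<alpha> \<in> Hom C (w \<otimes> v) (w \<otimes> ?wb)" by (rule tensor_in_Hom[OF i \<alpha>])
  have w\<alpha>': "?I w \<boxtimes> \<alpha>\<dagger> \<in> Hom C (w \<otimes> ?wb) (w \<otimes> v)" by (rule tensor_in_Hom[OF i \<alpha>'])
  have inv1: "(?I w \<boxtimes> \<alpha>) \<cdot> (?I w \<boxtimes> \<alpha>\<dagger>) = ?I (w \<otimes> ?wb)"
    using tensor_compose_ident_left[OF \<alpha> \<alpha>', of w] \<alpha>2 by (simp add: tensor_ident)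
  have inv2: "(?I w \<boxtimes> \<alpha>\<dagger>) \<cdot> (?I w \<boxtimes> \<alpha>) = ?I (w \<otimes> v)"
    using tensor_compose_ident_left[OF \<alpha>' \<alpha>, of w] \<alpha>1 by (simp add: tensor_ident)
  have kw: "k\<dagger> \<boxtimes> ?I ?wb \<in> Hom C (w \<otimes> ?wb) (w \<otimes> x \<otimes> ?wb)"
    using tensor_in_Hom[OF adjoint_in_Hom[OF k(1)] i[of ?wb]] by simp
  have kRb: "(k\<dagger> \<boxtimes> ?I ?wb) \<cdot> ?Rb \<noteq> 0"
  proof
    assume "(k\<dagger> \<boxtimes> ?I ?wb) \<cdot> ?Rb = 0"
    then have "k\<dagger> = 0"
      using frobenius_back(2)[OF std_conjugate adjoint_in_Hom[OF k(1)]] tensor_zero_left[OF i]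
        compose_zero_right[OF tensor_in_Hom[OF i adjoint_in_Hom[OF std_in_Hom(1)]]] by metis
    then show False using k adjoint_adjoint[OF k(1)] adjoint_zero by metis
  qed
  then have Rb0: "?Rb \<noteq> 0" using compose_zero_right[OF kw] by metis
  have D: "hom_orthonormal_basis C (unit_ob C) (w \<otimes> v) (onb C (unit_ob C) (w \<otimes> v))"
    by (rule onb_unit[OF sv Irr_simple[OF w]])
  have "(?I w \<boxtimes> \<alpha>\<dagger>) \<cdot> ?Rb \<in> Hom C (unit_ob C) (w \<otimes> v)" by (rule compose_in_Hom[OF w\<alpha>' Rb])
  moreover have "(?I w \<boxtimes> \<alpha>\<dagger>) \<cdot> ?Rb \<noteq> 0"
  proof
    assume "(?I w \<boxtimes> \<alpha>\<dagger>) \<cdot> ?Rb = 0"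
    then have "?Rb = 0"
      using compose_assoc[OF w\<alpha> w\<alpha>' Rb] inv1 ident_compose[OF Rb] compose_zero_right[OF w\<alpha>] by simp
    then show False using Rb0 by simp
  qed
  ultimately have "onb C (unit_ob C) (w \<otimes> v) \<noteq> {}"
    using D unfolding hom_orthonormal_basis_def by (metis empty_iff insert_iff span_empty)
  then obtain T where TD: "T \<in> onb C (unit_ob C) (w \<otimes> v)" by blast
  have T: "T \<in> Hom C (unit_ob C) (w \<otimes> v)" using D TD by (auto simp: hom_orthonormal_basis_def)
  have T0: "T \<noteq> 0"
    using orthonormal_basis_isometry[OF unit_simple D TD] simple_ident_nonzero[OF unit_simple]
      compose_zero_right[OF adjoint_in_Hom[OF T]] by auto
  obtain c where c: "(?I w \<boxtimes> \<alpha>) \<cdot> T = c \<star> ?Rb"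
    using Hom_unit_conj(2)[OF w w compose_in_Hom[OF w\<alpha> T]] by blast
  have "c \<noteq> 0"
  proof
    assume "c = 0"
    then have "T = 0"
      using c compose_assoc[OF w\<alpha>' w\<alpha> T] inv2 ident_compose[OF T] compose_zero_right[OF w\<alpha>'] by simp
    then show False using T0 by simp
  qed
  then have "gram_vector w k \<alpha> T \<noteq> 0"
    unfolding gram_vector_def c using compose_scale_right[OF kw Rb] kRb by simp
  then show ?thesis using that v \<alpha>B TD by blast
qed

lemma onb_conj_elements:
  assumes "v \<in> Irr C" "w \<in> Irr C"
  shows "finite (onb C v (conj_ob C w))" "\<alpha> \<in> onb C v (conj_ob C w) \<Longrightarrow> \<alpha> \<in> Hom C v (conj_ob C w)"
  using onb_simple[OF Irr_simple[OF assms(1)] conjugate_simple[OF std_conjugate Irr_simple[OF assms(2)]]]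
  unfolding hom_orthonormal_basis_def by auto

lemma onb_unit_elements:
  assumes "v \<in> Irr C" "w \<in> Irr C"
  shows "finite (onb C (unit_ob C) (w \<otimes> v))"
    "T \<in> onb C (unit_ob C) (w \<otimes> v) \<Longrightarrow> T \<in> Hom C (unit_ob C) (w \<otimes> v)"
  using onb_unit[OF Irr_simple[OF assms(1)] Irr_simple[OF assms(2)]]
  unfolding hom_orthonormal_basis_def by auto

text \<open>
  The support of \<open>a\<close> is finite, and for each of its elements \<open>w\<close> only the representative of
  \<open>conj_ob C w\<close> can occur. Finiteness matters because a sum over an infinite set is \<open>0\<close> by
  convention, so that without it a vanishing product would say nothing about the summands.
\<close>

lemma tube_star_finite_support:
  assumes a: "a \<in> tube_space C x (unit_ob C)" and x: "x \<in> Irr C"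
  shows "finite {v. tube_star C a (unit_ob C) x v \<noteq> 0}"
proof (rule finite_subset)
  let ?W = "{w. a x (unit_ob C) w \<noteq> 0}"
  note W = tube_space_components(1,2)[OF a x]
  show "{v. tube_star C a (unit_ob C) x v \<noteq> 0} \<subseteq>
      (\<Union>w\<in>?W. {v\<in>Irr C. isomorphic C v (conj_ob C w)})"
  proof
    fix v assume v: "v \<in> {v. tube_star C a (unit_ob C) x v \<noteq> 0}"
    then have vI: "v \<in> Irr C"
      using tube_star_component[OF a x, of "unit_ob C" x v] by (auto split: if_splits)
    have "\<exists>w\<in>?W. onb C v (conj_ob C w) \<noteq> {}"
    proof (rule ccontr)
      assume "\<not> (\<exists>w\<in>?W. onb C v (conj_ob C w) \<noteq> {})"
      then have "tube_star C a (unit_ob C) x v = 0"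
        unfolding tube_star_component[OF a x] by (auto intro!: sum.neutral)
      then show False using v by simp
    qed
    then obtain w \<alpha> where w: "w \<in> ?W" and \<alpha>: "\<alpha> \<in> onb C v (conj_ob C w)" by blast
    then have wI: "w \<in> Irr C" using W by blast
    have swb: "simple C (conj_ob C w)" by (rule conjugate_simple[OF std_conjugate Irr_simple[OF wI]])
    note \<alpha>H = onb_conj_elements(2)[OF vI wI \<alpha>]
    have "\<alpha>\<dagger> \<cdot> \<alpha> = ident C v"
      using orthonormal_basis_isometry[OF _ onb_simple \<alpha>] Irr_simple[OF vI] swb by blast
    then have "\<alpha> \<noteq> 0"
      using simple_ident_nonzero[OF Irr_simple[OF vI]] compose_zero_right[OF adjoint_in_Hom[OF \<alpha>H]]
      by auto
    then have "isomorphic C v (conj_ob C w)"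
      using simple_nonzero_isomorphic[OF Irr_simple[OF vI] swb \<alpha>H] by blast
    then show "v \<in> (\<Union>w\<in>?W. {v\<in>Irr C. isomorphic C v (conj_ob C w)})" using vI w by blast
  qed
  have "finite {v\<in>Irr C. isomorphic C v (conj_ob C w)}" if "w \<in> ?W" for w
  proof -
    have "simple C (conj_ob C w)"
      using conjugate_simple[OF std_conjugate Irr_simple] that W by blast
    then obtain v0 where "v = v0" if "v \<in> Irr C" "isomorphic C v (conj_ob C w)" for v
      using Irr_representative_unique by metis
    then have "{v\<in>Irr C. isomorphic C v (conj_ob C w)} \<subseteq> {v0}" by blast
    then show ?thesis by (rule finite_subset) simp
  qed
  then show "finite (\<Union>w\<in>?W. {v\<in>Irr C. isomorphic C v (conj_ob C w)})"
    using W(1) by blast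
qed

text \<open>
  Expanding the star of \<open>a\<close> produces one term for each \<open>w\<close> in the support of \<open>a\<close>, of which only
  \<open>w = u\<close> survives.
\<close>

lemma square_summand:
  assumes a: "a \<in> tube_space C x (unit_ob C)" and x: "x \<in> Irr C"
    and u: "a x (unit_ob C) u \<noteq> 0" and v: "v \<in> Irr C" and TB: "T \<in> onb C (unit_ob C) (u \<otimes> v)"
  defines "G \<equiv> \<lambda>\<alpha>. gram_vector u (a x (unit_ob C) u) \<alpha> T"
  shows "(ident C (unit_ob C) \<boxtimes> T\<dagger>) \<cdot>
      ((a x (unit_ob C) u \<boxtimes> ident C v) \<cdot> (ident C u \<boxtimes> tube_star C a (unit_ob C) x v)) \<cdot>
      (T \<boxtimes> ident C (unit_ob C))
    = (\<Sum>\<alpha>\<in>onb C v (conj_ob C u). (G \<alpha>)\<dagger> \<cdot> G \<alpha>)"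
proof -
  let ?I = "ident C" and ?u = "unit_ob C"
  define g where "g = a x ?u"
  define W where "W = {w. g w \<noteq> 0}"
  have W: "finite W" "W \<subseteq> Irr C" and uW: "u \<in> W"
    using tube_space_components(1,2)[OF a x] u unfolding W_def g_def by auto
  have g: "g w \<in> Hom C (w \<otimes> x) w" if "w \<in> Irr C" for w
    using tube_space_components(4)[OF a x that] unfolding g_def .
  note i = ident_in_Hom
  have uI: "u \<in> Irr C" using uW W by blast
  note T = onb_unit_elements(2)[OF v uI TB]
  note T' = adjoint_in_Hom[OF T]
  define h where "h w \<alpha> = (?I x \<boxtimes> \<alpha>\<dagger>) \<cdot> rotation C w x ?u (g w) \<cdot> \<alpha>" for w \<alpha>
  have h: "h w \<alpha> \<in> Hom C v (x \<otimes> v)" if "w \<in> W" "\<alpha> \<in> onb C v (conj_ob C w)" for w \<alpha>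
  proof -
    have wI: "w \<in> Irr C" using that W by blast
    note \<alpha> = onb_conj_elements(2)[OF v wI that(2)]
    have "rotation C w x ?u (g w) \<in> Hom C (conj_ob C w) (x \<otimes> conj_ob C w)"
      using rotation_in_Hom[of "g w" w x ?u] g[OF wI] by (simp add: unit_tensor_ob tensor_ob_unit)
    then show ?thesis unfolding h_def
      using compose_in_Hom[OF compose_in_Hom[OF tensor_in_Hom[OF i adjoint_in_Hom[OF \<alpha>]]] \<alpha>] by blast
  qed
  have "tube_star C a ?u x v = (\<Sum>w\<in>W. \<Sum>\<alpha>\<in>onb C v (conj_ob C w).
      (?I x \<boxtimes> \<alpha>\<dagger>) \<cdot> rotation C w x ?u (g w) \<cdot> (\<alpha> \<boxtimes> ?I ?u))"
    unfolding g_def W_def using tube_star_component[OF a x] v by simp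
  also have "\<dots> = (\<Sum>w\<in>W. \<Sum>\<alpha>\<in>onb C v (conj_ob C w). h w \<alpha>)"
    unfolding h_def
  proof (intro sum.cong refl)
    fix w \<alpha> assume "w \<in> W" "\<alpha> \<in> onb C v (conj_ob C w)"
    then have "\<alpha> \<in> Hom C v (conj_ob C w)" using onb_conj_elements(2)[OF v] W by blast
    then show "(?I x \<boxtimes> \<alpha>\<dagger>) \<cdot> rotation C w x ?u (g w) \<cdot> (\<alpha> \<boxtimes> ?I ?u)
      = (?I x \<boxtimes> \<alpha>\<dagger>) \<cdot> rotation C w x ?u (g w) \<cdot> \<alpha>" using tensor_unit by simp
  qed
  finally have b: "tube_star C a ?u x v = (\<Sum>w\<in>W. \<Sum>\<alpha>\<in>onb C v (conj_ob C w). h w \<alpha>)" .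
  have gu: "g u \<boxtimes> ?I v \<in> Hom C (u \<otimes> x \<otimes> v) (u \<otimes> v)" by (rule tensor_in_Hom[OF g[OF uI] i])
  \<comment> \<open>the compression by \<open>T\<close>, as a linear function of the component of the star of \<open>a\<close>\<close>
  define L where "L m = T\<dagger> \<cdot> ((g u \<boxtimes> ?I v) \<cdot> (?I u \<boxtimes> m)) \<cdot> T" for m
  have L_sum: "L (\<Sum>j\<in>J. m j) = (\<Sum>j\<in>J. L (m j))" if "\<And>j. j \<in> J \<Longrightarrow> m j \<in> Hom C v (x \<otimes> v)"
    for J :: "'j set" and m
  proof -
    have um: "?I u \<boxtimes> m j \<in> Hom C (u \<otimes> v) (u \<otimes> x \<otimes> v)" if "j \<in> J" for j
      using tensor_in_Hom[OF i[of u] \<open>\<And>j. j \<in> J \<Longrightarrow> m j \<in> _\<close>[OF that]] by (simp add: tensor_ob_assoc)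
    have "?I u \<boxtimes> (\<Sum>j\<in>J. m j) = (\<Sum>j\<in>J. ?I u \<boxtimes> m j)"
      by (rule tensor_sum_right[OF i that])
    also have "(g u \<boxtimes> ?I v) \<cdot> \<dots> = (\<Sum>j\<in>J. (g u \<boxtimes> ?I v) \<cdot> (?I u \<boxtimes> m j))"
      by (rule compose_sum_right[OF gu um])
    also have "T\<dagger> \<cdot> \<dots> = (\<Sum>j\<in>J. T\<dagger> \<cdot> ((g u \<boxtimes> ?I v) \<cdot> (?I u \<boxtimes> m j)))"
      by (rule compose_sum_right[OF T' compose_in_Hom[OF gu um]])
    also have "\<dots> \<cdot> T = (\<Sum>j\<in>J. T\<dagger> \<cdot> ((g u \<boxtimes> ?I v) \<cdot> (?I u \<boxtimes> m j)) \<cdot> T)"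
      by (rule compose_sum_left[OF T compose_in_Hom[OF T' compose_in_Hom[OF gu um]]])
    finally show ?thesis unfolding L_def .
  qed
  have L_term: "L (h w \<alpha>) = (if u = w then (G \<alpha>)\<dagger> \<cdot> G \<alpha> else 0)"
    if "w \<in> W" "\<alpha> \<in> onb C v (conj_ob C w)" for w \<alpha>
  proof -
    have wI: "w \<in> Irr C" using that W by blast
    note \<alpha> = onb_conj_elements(2)[OF v wI that(2)]
    have "L (h w \<alpha>) = (if u = w then (gram_vector w (g w) \<alpha> T)\<dagger> \<cdot> gram_vector w (g w) \<alpha> T else 0)"
      unfolding L_def h_def by (rule square_term[where g = g, OF uI wI g \<alpha> T])
    then show ?thesis by (auto simp: G_def g_def)
  qed
  have "L (tube_star C a ?u x v) = (\<Sum>w\<in>W. L (\<Sum>\<alpha>\<in>onb C v (conj_ob C w). h w \<alpha>))"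
    unfolding b by (rule L_sum) (blast intro: sum_in_Hom h)
  also have "\<dots> = (\<Sum>w\<in>W. \<Sum>\<alpha>\<in>onb C v (conj_ob C w). L (h w \<alpha>))"
    by (intro sum.cong refl L_sum) (rule h)
  also have "\<dots> = (\<Sum>w\<in>W. if u = w then \<Sum>\<alpha>\<in>onb C v (conj_ob C u). (G \<alpha>)\<dagger> \<cdot> G \<alpha> else 0)"
    by (intro sum.cong refl) (simp add: L_term)
  also have "\<dots> = (\<Sum>\<alpha>\<in>onb C v (conj_ob C u). (G \<alpha>)\<dagger> \<cdot> G \<alpha>)"
    using W(1) uW by (simp add: sum.delta)
  finally show ?thesis
    unfolding L_def g_def using unit_tensor[OF T'] tensor_unit[OF T] by simp
qed

text \<open>
  This is faithfulness of the trace of the tube algebra on \<open>tube_space C x (unit_ob C)\<close>, up to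
  normalization. The number \<open>p\<close> is the sum of the squared norms \<open>q w \<alpha> T\<close> of the vectors
  \<open>gram_vector w (g w) \<alpha> T\<close>.
\<close>

lemma unit_component_of_square:
  assumes a: "a \<in> tube_space C x (unit_ob C)" and x: "x \<in> Irr C"
  obtains p where "p \<ge> 0"
    "tube_mult C a (tube_star C a) (unit_ob C) (unit_ob C) (unit_ob C)
       = complex_of_real p \<star> ident C (unit_ob C)"
    "p = 0 \<Longrightarrow> a = 0"
proof -
  let ?I = "ident C" and ?u = "unit_ob C"
  define g where "g = a x ?u"
  define W where "W = {w. g w \<noteq> 0}"
  define b where "b = tube_star C a ?u x"
  have W: "finite W" "W \<subseteq> Irr C"
    using tube_space_components(1,2)[OF a x] unfolding W_def g_def by auto
  have g: "g w \<in> Hom C (w \<otimes> x) w" if "w \<in> Irr C" for w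
    using tube_space_components(4)[OF a x that] unfolding g_def .
  note i = ident_in_Hom
  have V: "v \<in> Irr C" if "b v \<noteq> 0" for v
    using that tube_star_component[OF a x, of ?u x v] unfolding b_def by (auto split: if_splits)
  note \<alpha>s = onb_conj_elements and Ts = onb_unit_elements
  define q where "q w \<alpha> T = Re (hom_inner C ?u (gram_vector w (g w) \<alpha> T) (gram_vector w (g w) \<alpha> T))" for w \<alpha> T
  have q: "q w \<alpha> T \<ge> 0" "q w \<alpha> T = 0 \<longleftrightarrow> gram_vector w (g w) \<alpha> T = 0"
    "(gram_vector w (g w) \<alpha> T)\<dagger> \<cdot> gram_vector w (g w) \<alpha> T = complex_of_real (q w \<alpha> T) \<star> ?I ?u"
    if mem: "w \<in> Irr C" "\<alpha> \<in> Hom C v (conj_ob C w)" "T \<in> Hom C ?u (w \<otimes> v)" for w v \<alpha> T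
  proof -
    obtain r where r: "r \<ge> 0" "(gram_vector w (g w) \<alpha> T)\<dagger> \<cdot> gram_vector w (g w) \<alpha> T = complex_of_real r \<star> ?I ?u"
      "r = 0 \<longleftrightarrow> gram_vector w (g w) \<alpha> T = 0"
      using adjoint_compose_self_simple[OF unit_simple gram_vector_in_Hom[OF g[OF mem(1)] mem(2,3)]] .
    have "q w \<alpha> T = r" unfolding q_def hom_inner_eqI[OF unit_simple r(2)] by simp
    then show "q w \<alpha> T \<ge> 0" "q w \<alpha> T = 0 \<longleftrightarrow> gram_vector w (g w) \<alpha> T = 0"
      "(gram_vector w (g w) \<alpha> T)\<dagger> \<cdot> gram_vector w (g w) \<alpha> T = complex_of_real (q w \<alpha> T) \<star> ?I ?u"
      using r by simp_all
  qed
  define E where "E w v = (\<Sum>T\<in>onb C ?u (w \<otimes> v). \<Sum>\<alpha>\<in>onb C v (conj_ob C w). q w \<alpha> T)" for w v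
  have E0: "E w v \<ge> 0" if "w \<in> Irr C" "v \<in> Irr C" for w v
    unfolding E_def using q(1) \<alpha>s Ts that by (intro sum_nonneg) blast
  have expand: "(?I ?u \<boxtimes> T\<dagger>) \<cdot> ((g u \<boxtimes> ?I v) \<cdot> (?I u \<boxtimes> b v)) \<cdot> (T \<boxtimes> ?I ?u)
      = complex_of_real (\<Sum>\<alpha>\<in>onb C v (conj_ob C u). q u \<alpha> T) \<star> ?I ?u"
    if u: "u \<in> W" and v: "v \<in> Irr C" and TB: "T \<in> onb C ?u (u \<otimes> v)" for u v T
  proof -
    have uI: "u \<in> Irr C" and u0: "a x ?u u \<noteq> 0" using u W by (auto simp: W_def g_def)
    have "(?I ?u \<boxtimes> T\<dagger>) \<cdot> ((g u \<boxtimes> ?I v) \<cdot> (?I u \<boxtimes> b v)) \<cdot> (T \<boxtimes> ?I ?u)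
        = (\<Sum>\<alpha>\<in>onb C v (conj_ob C u). complex_of_real (q u \<alpha> T) \<star> ?I ?u)"
      unfolding g_def b_def square_summand[OF a x u0 v TB]
      using q(3)[OF uI \<alpha>s(2)[OF v uI] Ts(2)[OF v uI TB]] by (intro sum.cong refl) (simp add: g_def)
    then show ?thesis by (simp add: scale_sum_left)
  qed
  have expand_sum: "(\<Sum>T\<in>onb C ?u (u \<otimes> v).
        (?I ?u \<boxtimes> T\<dagger>) \<cdot> ((g u \<boxtimes> ?I v) \<cdot> (?I u \<boxtimes> b v)) \<cdot> (T \<boxtimes> ?I ?u))
      = complex_of_real (E u v) \<star> ?I ?u" if "u \<in> W" "v \<in> Irr C" for u v
    unfolding E_def using expand[OF that] by (simp add: scale_sum_left)
  define p where "p = (\<Sum>u\<in>W. \<Sum>v | b v \<noteq> 0. E u v)"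
  have "tube_mult C a (tube_star C a) ?u ?u ?u
      = (\<Sum>u\<in>W. \<Sum>v | b v \<noteq> 0. complex_of_real (E u v) \<star> ?I ?u)"
    unfolding tube_mult_unit_component[OF a x]
    using expand_sum V by (simp add: W_def g_def b_def)
  then have comp: "tube_mult C a (tube_star C a) ?u ?u ?u = complex_of_real p \<star> ?I ?u"
    by (simp add: p_def scale_sum_left)
  have p0: "p \<ge> 0" unfolding p_def using E0 V W by (intro sum_nonneg) blast
  have "a = 0" if "p = 0"
  proof -
    have finV: "finite {v. b v \<noteq> 0}" unfolding b_def by (rule tube_star_finite_support[OF a x])
    have "W = {}"
    proof (rule ccontr)
      assume "W \<noteq> {}"
      then obtain w where w: "w \<in> W" by blast
      then have wI: "w \<in> Irr C" and w0: "g w \<noteq> 0" using W by (auto simp: W_def)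
      obtain v \<alpha> T where v: "v \<in> Irr C" "\<alpha> \<in> onb C v (conj_ob C w)" "T \<in> onb C ?u (w \<otimes> v)"
        "gram_vector w (g w) \<alpha> T \<noteq> 0"
        using gram_vector_nonzero[OF wI g[OF wI] w0] .
      \<comment> \<open>the product runs over the support of the star of \<open>a\<close> only, but outside of it \<open>E w v\<close> is the
        compression of a zero morphism\<close>
      have "E w v = 0"
      proof (cases "b v = 0")
        case True
        have "(?I ?u \<boxtimes> T\<dagger>) \<cdot> ((g w \<boxtimes> ?I v) \<cdot> (?I w \<boxtimes> b v)) \<cdot> (T \<boxtimes> ?I ?u) = 0"
          if "T \<in> onb C ?u (w \<otimes> v)" for T
        proof -
          note T = Ts(2)[OF v(1) wI that]
          show ?thesis
            unfolding True tensor_zero_right[OF i]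
            using compose_zero_right[OF tensor_in_Hom[OF g[OF wI] i]]
              compose_zero_right[OF tensor_in_Hom[OF i adjoint_in_Hom[OF T]]]
              compose_zero_left[OF tensor_in_Hom[OF T i]] by simp
        qed
        then show ?thesis
          using expand_sum[OF w v(1)] simple_ident_nonzero[OF unit_simple] by simp
      next
        case False
        have "(\<Sum>v | b v \<noteq> 0. E w v) = 0"
          using that w W V E0 unfolding p_def
          by (subst (asm) sum_nonneg_eq_0_iff) (auto intro!: sum_nonneg)
        then show ?thesis
          using finV V E0 wI False by (subst (asm) sum_nonneg_eq_0_iff) auto
      qed
      moreover have q0: "q w \<alpha>' T' \<ge> 0"
        if "\<alpha>' \<in> onb C v (conj_ob C w)" "T' \<in> onb C ?u (w \<otimes> v)" for \<alpha>' T'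
        using q(1)[OF wI \<alpha>s(2)[OF v(1) wI that(1)] Ts(2)[OF v(1) wI that(2)]] .
      ultimately have "(\<Sum>\<alpha>\<in>onb C v (conj_ob C w). q w \<alpha> T) = 0"
        using v(3) Ts(1)[OF v(1) wI] unfolding E_def
        by (subst (asm) sum_nonneg_eq_0_iff) (auto intro!: sum_nonneg)
      then have "q w \<alpha> T = 0"
        using v(2,3) \<alpha>s(1)[OF v(1) wI] q0 by (subst (asm) sum_nonneg_eq_0_iff) auto
      then show False using q(2)[OF wI] v \<alpha>s(2)[OF v(1) wI] Ts(2)[OF v(1) wI] by blast
    qed
    then have "tube_support a = {}" using tube_space_components(3)[OF a x] by (simp add: W_def g_def)
    then show "a = 0" by (auto simp: tube_support_def fun_eq_iff)
  qed
  then show ?thesis using that p0 comp by blast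
qed

section \<open>The unit coefficient on the tube cone\<close>

lemma cone_unit_coefficient:
  assumes f: "f \<in> tube_cone C"
  shows "\<exists>p\<ge>0. f (unit_ob C) = complex_of_real p \<and> (p = 0 \<longrightarrow> f = 0)"
proof -
  let ?u = "unit_ob C"
  obtain n :: nat and a where fa: "f \<in> fusion_algebra C" and a: "\<forall>i<n. \<exists>x\<in>Irr C. a i \<in> tube_space C x ?u"
    and eq: "fusion_embed C f = (\<Sum>i<n. tube_mult C (a i) (tube_star C (a i)))"
    using f unfolding tube_cone_def by blast
  have "\<exists>p\<ge>0. tube_mult C (a i) (tube_star C (a i)) ?u ?u ?u = complex_of_real p \<star> ident C ?u
      \<and> (p = 0 \<longrightarrow> a i = 0)" if "i < n" for i
    using a that unit_component_of_square by metis
  then obtain p where p: "\<And>i. i < n \<Longrightarrow> p i \<ge> 0"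
    "\<And>i. i < n \<Longrightarrow> tube_mult C (a i) (tube_star C (a i)) ?u ?u ?u = complex_of_real (p i) \<star> ident C ?u"
    "\<And>i. i < n \<Longrightarrow> p i = 0 \<Longrightarrow> a i = 0" by metis
  have "f ?u \<star> ident C ?u = (\<Sum>i<n. complex_of_real (p i) \<star> ident C ?u)"
    using fusion_embed_component[OF fa unit_Irr] p(2) unfolding eq by (simp add: sum_fun_apply)
  also have "\<dots> = complex_of_real (\<Sum>i<n. p i) \<star> ident C ?u" by (simp add: scale_sum_left)
  finally have fu: "f ?u = complex_of_real (\<Sum>i<n. p i)"
    using simple_ident_nonzero[OF unit_simple] by (metis scale_right_imp_eq)
  have "f = 0" if "(\<Sum>i<n. p i) = 0"
  proof -
    have "p i = 0" if "i < n" for i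
      using that p(1) \<open>(\<Sum>i<n. p i) = 0\<close> by (subst (asm) sum_nonneg_eq_0_iff) auto
    then have "a i = 0" if "i < n" for i using p(3) that by blast
    moreover have "tube_mult C 0 b = 0" for b by (auto simp: tube_mult_def tube_support_def intro!: sum.neutral)
    ultimately have "fusion_embed C f = 0" unfolding eq by simp
    then have "f v = 0" if "v \<in> Irr C" for v
      using fusion_embed_component[OF fa that] simple_ident_nonzero[OF Irr_simple[OF that]] by simp
    then show "f = 0" using fa by (auto simp: fusion_algebra_def fun_eq_iff)
  qed
  moreover have "(\<Sum>i<n. p i) \<ge> 0" using p(1) by (intro sum_nonneg) auto
  ultimately show ?thesis using fu by blast
qed

end

theorem proposition3p4:
  fixes C :: "('o, 'm::ab_group_add, 'z) tube_data_scheme"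
  assumes "rigid_cstar_tensor_category C"
    and "simple C (unit_ob C)"
    and "countable (simple_iso_classes C)"
    and "simple_representatives C"
    and "standard_choice C"
  shows "tube_cone C \<inter> uminus ` tube_cone C = {0}"
proof -
  interpret tube_setting C
    using assms by (simp add: tube_setting_def tube_setting_axioms_def)
  have "0 \<in> tube_cone C"
    unfolding tube_cone_def fusion_algebra_def fusion_embed_def by (auto intro!: exI[of _ 0])
  moreover have "(0 :: 'o \<Rightarrow> complex) = - 0" by simp
  moreover have "f = 0" if f: "f \<in> tube_cone C" and g: "g \<in> tube_cone C" "f = - g" for f g
  proof -
    obtain p where p: "p \<ge> 0" "f (unit_ob C) = complex_of_real p" "p = 0 \<longrightarrow> f = 0"
      using cone_unit_coefficient[OF f] by blast
    obtain q where q: "q \<ge> 0" "g (unit_ob C) = complex_of_real q"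
      using cone_unit_coefficient[OF g(1)] by blast
    have "p = - q" using p(2) q(2) g(2) by (metis fun_Compl_def of_real_eq_iff of_real_minus)
    then show ?thesis using p q by auto
  qed
  ultimately show ?thesis by blast
qed

end
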